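(* Let $P$ be a planar diagram subordinate to a disc configuration $\mathbb{D}$, with signature $(n_0;n_1,\dots,n_m)$. The partition map $Z_P$ has the following properties. (1) (Temperley-Lieb property) If $P$ has a circle component embedded in the interior of $\Sigma_{\mathbb{D}}$, then $Z_P=(q+q^{-1})Z_{P'}$, where $P'$ is the planar diagram obtained from $P$ by removing this component. (2) (Conjugation property) The map on cleaved links reversing the decoration of every component is an involution of $\mathcal{CL}_n$ for every $n$; extend it to a map $\xi\mapsto\xi^\ast$ on $\mathcal{I}_{2n}$ and on tensor products of such modules, semilinearly with respect to $p(q)\mapsto p^\ast(q)=p(q^{-1})$. For this map, $Z_P(\xi^\ast)=Z_P(\xi)^\ast$ for all $\xi\in\mathcal{I}_{2n_1}\otimes\cdots\otimes\mathcal{I}_{2n_m}$.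
   Context: Write $\Lambda=\mathbb{Z}[q^{1/2},q^{-1/2}]$; all tensor products are over $\Lambda$ (an empty tensor product is $\Lambda$). Everything is smooth. Disc configurations and planar diagrams. Let $S$ be an oriented two-sphere. A disc configuration $\mathbb{D}=(D_0;D_1,\dots,D_m)$, $m\ge 0$, is an ordered collection of closed discs embedded in $S$, with a marked point $\ast_i\in\partial D_i$ for each $i$, such that $D_i\subset \mathrm{int}\,D_0$ for $i\ge1$ and $D_i\cap D_j=\emptyset$ for distinct $i,j\ge1$. Each $D_i$ is oriented by $S$ and $\partial D_i$ is oriented as its boundary. Put $\Sigma_{\mathbb{D}}=D_0\setminus\bigcup_{i\ge1}\mathrm{int}\,D_i$. A planar diagram $P$ subordinate to $\mathbb{D}$ is a (possibly empty, finite) set of arcs and circles properly and disjointly embedded in $\Sigma_{\mathbb{D}}$, with endpoints away from the marked points, meeting each $\partial D_i$ in an even number $2n_i$ of points. The points of $P\cap\partial D_i$ are ordered along the oriented interval $\partial D_i\setminus\{\ast_i\}$. The signature is $\mathrm{Sign}(P)=(n_0;n_1,\dots,n_m)$. Cleaved links. For an oriented circle $C\subset S$ (the equator) bounding an inside disc $D$ (with $C$ oriented as $\partial D$), a marked point $\ast\in C$ and a set $Q\subset C\setminus\{\ast\}$ of $2n$ points, $\mathcal{CL}_n$ is the set of equivalence classes of pairs $(L,\sigma)$, where $L\subset S$ is a finite disjoint union of embedded circles, each component meets $C$ transversely and non-trivially, $L\cap C=Q$, and $\sigma:\{\text{components of }L\}\to\{+,-\}$ is a decoration. Two pairs are equivalent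 if an orientation-preserving diffeomorphism of spheres carries one oriented equator, marked point, link and decoration to the other. $\mathcal{I}_{2n}$ is the free $\Lambda$-module with basis $\{I_{(L,\sigma)}:(L,\sigma)\in\mathcal{CL}_n\}$; $\mathcal{I}_0=\Lambda I_0\cong\Lambda$, where $I_0$ corresponds to the empty link. Multiply cleaved links. A decorated multiply cleaved link subordinate to $\mathbb{D}$ is a pair $(M,\sigma)$, where $M\subset S$ is a finite (possibly empty) disjoint union of embedded circles, transverse to every $\partial D_i$ and missing every $\ast_i$, with no component contained in $S\setminus D_0$ or in $\mathrm{int}\,D_i$ ($i\ge1$), and $\sigma$ assigns $+$ or $-$ to each component. For a planar diagram $P$ subordinate to $\mathbb{D}$, $\mathcal{M}(P)$ is the set of such $(M,\sigma)$ with $M\cap\Sigma_{\mathbb{D}}=P$, two being identified if they differ by a diffeomorphism of $S$ that is the identity on $\Sigma_{\mathbb{D}}$ and respects decorations. For $0\le i\le m$, the boundary $\partial_i(M,\sigma)\in\mathcal{CL}_{n_i}$ is the cleaved link with equator $\partial D_i$, inside disc $D_i$ and marked point $\ast_i$, consisting of those components of $M$ that meet $\partial D_i$, with the restricted decoration. Weights and partition maps. For a component $K$ of $M$, let $N_M(K)$ be the number of circles among $\partial D_0,\dots,\partial D_m$ that meet $K$. The weight is $W(M,\sigma)=\prod_{\sigma(K)=+}q^{1-\frac12N_M(K)}\prod_{\sigma(K)=-}q^{-1+\frac12N_M(K)}\in\Lambda$ ($=1$ if $M=\emptyset$). The partition map $Z_P:\mathcal{I}_{2n_1}\otimes\cdots\otimes\mathcal{I}_{2n_m}\to\mathcal{I}_{2n_0}$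 is the $\Lambda$-linear map with $$Z_P\big(I_{(L_1,\sigma_1)}\otimes\cdots\otimes I_{(L_m,\sigma_m)}\big)=\sum W(M,\sigma)\,I_{\partial_0(M,\sigma)},$$ the sum being over $(M,\sigma)\in\mathcal{M}(P)$ with $\partial_i(M,\sigma)=(L_i,\sigma_i)$ for all $i\ge1$. Conjugation. For $p\in\Lambda$, $p^\ast(q)=p(q^{-1})$ (so $q^{1/2}\mapsto q^{-1/2}$). For a cleaved link, $(L,\sigma)^\ast=(L,\sigma')$ with $\sigma'$ the opposite decoration on every component. On tensor products, $\ast$ is the additive extension of $p(q)\,I_{(L_1,\sigma_1)}\otimes\cdots\otimes I_{(L_m,\sigma_m)}\mapsto p^\ast(q)\,I_{(L_1,\sigma_1)^\ast}\otimes\cdots\otimes I_{(L_m,\sigma_m)^\ast}$. *)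

theory Defs
  imports "HOL-Analysis.Analysis" "HOL-Library.Poly_Mapping"
begin

section \<open>Smooth maps between subsets of Euclidean spaces\<close>

text \<open>\<open>k_smooth_on k U f\<close> is meant for open \<open>U\<close>: \<open>f\<close> is of class \<open>C\<^sup>k\<close> on \<open>U\<close>.\<close>

primrec k_smooth_on ::
  "nat \<Rightarrow> 'a::euclidean_space set \<Rightarrow> ('a \<Rightarrow> 'b::euclidean_space) \<Rightarrow> bool" where
  "k_smooth_on 0 U f \<longleftrightarrow> continuous_on U f"
| "k_smooth_on (Suc k) U f \<longleftrightarrow>
     (\<forall>x\<in>U. f differentiable (at x)) \<and>
     (\<forall>v. k_smooth_on k U (\<lambda>x. frechet_derivative f (at x) v))"

text \<open>A map on an arbitrary subset is smooth if it extends, near each point of the subset, to a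
  smooth map on an open set. With this notion, a subset of a Euclidean space that is diffeomorphic
  to a compact manifold (possibly with boundary) is a smoothly embedded copy of it.\<close>

definition smooth_map :: "'a::euclidean_space set \<Rightarrow> ('a \<Rightarrow> 'b::euclidean_space) \<Rightarrow> bool" where
  "smooth_map X f \<longleftrightarrow>
     (\<forall>x\<in>X. \<exists>U F. open U \<and> x \<in> U \<and> (\<forall>k. k_smooth_on k U F) \<and> (\<forall>y\<in>U \<inter> X. F y = f y))"

definition diffeo ::
  "'a::euclidean_space set \<Rightarrow> 'b::euclidean_space set \<Rightarrow> ('a \<Rightarrow> 'b) \<Rightarrow> bool" where
  "diffeo X Y f \<longleftrightarrow> bij_betw f X Y \<and> smooth_map X f \<and> smooth_map Y (inv_into X f)"

section \<open>Curves and discs in the oriented two-sphere\<close>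

text \<open>The oriented two-sphere is the unit sphere of three-space, oriented by the outward normal:
  a basis \<open>u, v\<close> of the tangent plane at \<open>x\<close> is positive iff \<open>x \<bullet> cross3 u v > 0\<close>.\<close>

type_synonym point = "real ^ 3"

definition S2 :: "point set" where
  "S2 = sphere 0 1"

text \<open>The derivative within \<open>S2\<close> is determined only on tangent vectors.\<close>

definition orientation_preserving :: "(point \<Rightarrow> point) \<Rightarrow> bool" where
  "orientation_preserving f \<longleftrightarrow>
     (\<forall>x\<in>S2. \<forall>f'. (f has_derivative f') (at x within S2) \<longrightarrow>
        (\<forall>u v. u \<bullet> x = 0 \<and> v \<bullet> x = 0 \<and> 0 < x \<bullet> cross3 u v \<longrightarrow> 0 < f x \<bullet> cross3 (f' u) (f' v)))"

definition embedded_circle :: "point set \<Rightarrow> bool" where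
  "embedded_circle K \<longleftrightarrow> K \<subseteq> S2 \<and> (\<exists>f. diffeo (sphere (0::complex) 1) K f)"

definition embedded_disc :: "point set \<Rightarrow> bool" where
  "embedded_disc D \<longleftrightarrow> D \<subseteq> S2 \<and> (\<exists>f. diffeo (cball (0::complex) 1) D f)"

text \<open>For an embedded disc these are the boundary circle and the open disc, by invariance of
  domain.\<close>

abbreviation frontier_S2 :: "point set \<Rightarrow> point set" where
  "frontier_S2 D \<equiv> top_of_set S2 frontier_of D"

abbreviation interior_S2 :: "point set \<Rightarrow> point set" where
  "interior_S2 D \<equiv> top_of_set S2 interior_of D"

definition tangent_vectors :: "point set \<Rightarrow> point \<Rightarrow> point set" where
  "tangent_vectors A x =
     {v. \<exists>\<gamma> e. 0 < e \<and> smooth_map {-e<..<e} \<gamma> \<and> \<gamma> ` {-e<..<e} \<subseteq> A \<and> \<gamma> (0::real) = x \<and>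
           (\<gamma> has_vector_derivative v) (at 0)}"

definition transverse :: "point set \<Rightarrow> point set \<Rightarrow> bool" where
  "transverse A B \<longleftrightarrow>
     (\<forall>x\<in>A \<inter> B. {u + v |u v. u \<in> tangent_vectors A x \<and> v \<in> tangent_vectors B x}
        = tangent_vectors S2 x)"

text \<open>A finite disjoint union of embedded circles; the circles are its components.\<close>

definition circle_union :: "point set \<Rightarrow> bool" where
  "circle_union L \<longleftrightarrow> finite (components L) \<and> (\<forall>K\<in>components L. embedded_circle K)"

section \<open>Disc configurations and planar diagrams\<close>

text \<open>Disc \<open>0\<close> is the outer disc; only the indices \<open>i \<le> num_discs\<close> are relevant.\<close>

record disc_config =
  num_discs :: nat
  disc :: "nat \<Rightarrow> point set"
  mark :: "nat \<Rightarrow> point"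

definition disc_configuration :: "disc_config \<Rightarrow> bool" where
  "disc_configuration \<D> \<longleftrightarrow>
     (\<forall>i\<le>num_discs \<D>. embedded_disc (disc \<D> i) \<and> mark \<D> i \<in> frontier_S2 (disc \<D> i)) \<and>
     (\<forall>i\<in>{1..num_discs \<D>}. disc \<D> i \<subseteq> interior_S2 (disc \<D> 0)) \<and>
     (\<forall>i\<in>{1..num_discs \<D>}. \<forall>j\<in>{1..num_discs \<D>}. i \<noteq> j \<longrightarrow> disc \<D> i \<inter> disc \<D> j = {})"

definition Sig :: "disc_config \<Rightarrow> point set" where
  "Sig \<D> = disc \<D> 0 - (\<Union>i\<in>{1..num_discs \<D>}. interior_S2 (disc \<D> i))"

definition proper_arc :: "disc_config \<Rightarrow> point set \<Rightarrow> bool" where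
  "proper_arc \<D> K \<longleftrightarrow>
     K \<subseteq> Sig \<D> \<and>
     (\<exists>f. diffeo {0..1::real} K f \<and> K \<inter> (\<Union>i\<le>num_discs \<D>. frontier_S2 (disc \<D> i)) = {f 0, f 1})"

definition proper_circle :: "disc_config \<Rightarrow> point set \<Rightarrow> bool" where
  "proper_circle \<D> K \<longleftrightarrow> embedded_circle K \<and> K \<subseteq> interior_S2 (Sig \<D>)"

text \<open>A planar diagram is represented by the union of its arcs and circles, which are recovered
  as the connected components.\<close>

definition planar_diagram :: "disc_config \<Rightarrow> point set \<Rightarrow> bool" where
  "planar_diagram \<D> P \<longleftrightarrow>
     finite (components P) \<and>
     (\<forall>K\<in>components P. proper_arc \<D> K \<or> proper_circle \<D> K) \<and>
     (\<forall>i\<le>num_discs \<D>. mark \<D> i \<notin> P \<and> even (card (P \<inter> frontier_S2 (disc \<D> i))))"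

definition half_points :: "disc_config \<Rightarrow> point set \<Rightarrow> nat \<Rightarrow> nat" where
  "half_points \<D> P i = card (P \<inter> frontier_S2 (disc \<D> i)) div 2"

section \<open>Cleaved links\<close>

datatype sign = Plus | Minus

primrec opp :: "sign \<Rightarrow> sign" where
  "opp Plus = Minus"
| "opp Minus = Plus"

text \<open>Values of a decoration on sets that are not components of the link are irrelevant: they are
  ignored by all the equivalence relations below.\<close>

type_synonym decoration = "point set \<Rightarrow> sign"

text \<open>A tuple \<open>(D, a, L, \<sigma>)\<close>: inside disc, marked point, link, decoration. The oriented equator
  is \<open>frontier_S2 D\<close> with the boundary orientation, so that the equator and its orientation are the same
  data as \<open>D\<close>. An orientation-preserving diffeomorphism of the sphere preserves oriented equators
  iff it preserves inside discs.\<close>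

type_synonym cleaved = "point set \<times> point \<times> point set \<times> decoration"

definition cleaved_links :: "nat \<Rightarrow> cleaved set" where
  "cleaved_links n =
     {(D, a, L, \<sigma>). embedded_disc D \<and> a \<in> frontier_S2 D \<and> circle_union L \<and> a \<notin> L \<and>
        (\<forall>K\<in>components L. transverse K (frontier_S2 D) \<and> K \<inter> frontier_S2 D \<noteq> {}) \<and>
        finite (L \<inter> frontier_S2 D) \<and> card (L \<inter> frontier_S2 D) = 2 * n}"

definition cl_rel :: "(cleaved \<times> cleaved) set" where
  "cl_rel =
     {((D, a, L, \<sigma>), (D', a', L', \<sigma>')).
        (\<exists>n. (D, a, L, \<sigma>) \<in> cleaved_links n \<and> (D', a', L', \<sigma>') \<in> cleaved_links n) \<and>
        (\<exists>f. diffeo S2 S2 f \<and> orientation_preserving f \<and> f ` D = D' \<and> f a = a' \<and> f ` L = L' \<and>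
             (\<forall>K\<in>components L. \<sigma>' (f ` K) = \<sigma> K))}"

type_synonym cl_class = "cleaved set"

definition CL :: "nat \<Rightarrow> cl_class set" where
  "CL n = cleaved_links n // cl_rel"

definition cl_of :: "cleaved \<Rightarrow> cl_class" where
  "cl_of x = cl_rel `` {x}"

definition reverse_cl :: "cl_class \<Rightarrow> cl_class" where
  "reverse_cl c = (\<lambda>(D, a, L, \<sigma>). (D, a, L, opp \<circ> \<sigma>)) ` c"

section \<open>Multiply cleaved links\<close>

type_synonym mcleaved = "point set \<times> decoration"

definition mcleaved_links :: "disc_config \<Rightarrow> mcleaved set" where
  "mcleaved_links \<D> =
     {(M, \<sigma>). circle_union M \<and>
        (\<forall>i\<le>num_discs \<D>. transverse M (frontier_S2 (disc \<D> i)) \<and> mark \<D> i \<notin> M) \<and>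
        (\<forall>K\<in>components M. \<not> K \<subseteq> S2 - disc \<D> 0 \<and>
           (\<forall>i\<in>{1..num_discs \<D>}. \<not> K \<subseteq> interior_S2 (disc \<D> i)))}"

definition mcl_rel :: "disc_config \<Rightarrow> (mcleaved \<times> mcleaved) set" where
  "mcl_rel \<D> =
     {((M, \<sigma>), (M', \<sigma>')).
        (M, \<sigma>) \<in> mcleaved_links \<D> \<and> (M', \<sigma>') \<in> mcleaved_links \<D> \<and>
        (\<exists>f. diffeo S2 S2 f \<and> (\<forall>x\<in>Sig \<D>. f x = x) \<and> f ` M = M' \<and>
             (\<forall>K\<in>components M. \<sigma>' (f ` K) = \<sigma> K))}"

definition MCL :: "disc_config \<Rightarrow> point set \<Rightarrow> mcleaved set set" where
  "MCL \<D> P = {(M, \<sigma>) \<in> mcleaved_links \<D>. M \<inter> Sig \<D> = P} // mcl_rel \<D>"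

definition boundary :: "disc_config \<Rightarrow> nat \<Rightarrow> mcleaved \<Rightarrow> cleaved" where
  "boundary \<D> i =
     (\<lambda>(M, \<sigma>). (disc \<D> i, mark \<D> i, \<Union>{K \<in> components M. K \<inter> frontier_S2 (disc \<D> i) \<noteq> {}}, \<sigma>))"

text \<open>The boundary and weight of a class are the common values on its representatives.\<close>

definition boundary_class :: "disc_config \<Rightarrow> nat \<Rightarrow> mcleaved set \<Rightarrow> cl_class" where
  "boundary_class \<D> i c = the_elem ((\<lambda>x. cl_of (boundary \<D> i x)) ` c)"

section \<open>Laurent polynomials and free modules\<close>

text \<open>Laurent polynomials in \<open>q\<^sup>1\<^sup>/\<^sup>2\<close> over the integers form the group ring of the integers, the
  exponent \<open>k\<close> standing for \<open>q\<^sup>k\<^sup>/\<^sup>2\<close>; the product of \<open>\<Rightarrow>\<^sub>0\<close> is convolution.\<close>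

type_synonym laurent = "int \<Rightarrow>\<^sub>0 int"

definition qhalf :: "int \<Rightarrow> laurent" where
  "qhalf k = Poly_Mapping.single k 1"

definition laurent_conj :: "laurent \<Rightarrow> laurent" where
  "laurent_conj p = Poly_Mapping.map_key uminus p"

text \<open>\<open>'b \<Rightarrow>\<^sub>0 laurent\<close> is the free module on \<open>'b\<close>.\<close>

definition lscale :: "laurent \<Rightarrow> ('b \<Rightarrow>\<^sub>0 laurent) \<Rightarrow> ('b \<Rightarrow>\<^sub>0 laurent)" where
  "lscale p \<xi> = Poly_Mapping.map (\<lambda>r. p * r) \<xi>"

definition linear_ext :: "('b \<Rightarrow> ('c \<Rightarrow>\<^sub>0 laurent)) \<Rightarrow> ('b \<Rightarrow>\<^sub>0 laurent) \<Rightarrow> ('c \<Rightarrow>\<^sub>0 laurent)" where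
  "linear_ext f \<xi> = (\<Sum>b\<in>Poly_Mapping.keys \<xi>. lscale (Poly_Mapping.lookup \<xi> b) (f b))"

definition semilinear_ext :: "('b \<Rightarrow> 'b) \<Rightarrow> ('b \<Rightarrow>\<^sub>0 laurent) \<Rightarrow> ('b \<Rightarrow>\<^sub>0 laurent)" where
  "semilinear_ext f \<xi> =
     (\<Sum>b\<in>Poly_Mapping.keys \<xi>.
        Poly_Mapping.single (f b) (laurent_conj (Poly_Mapping.lookup \<xi> b)))"

text \<open>A tensor product of free modules is free on the products of the bases: the list
  \<open>[c\<^sub>1, \<dots>, c\<^sub>m]\<close> stands for the tensor product of the basis elements \<open>c\<^sub>1, \<dots>, c\<^sub>m\<close>, and the empty
  list for the unit of the ground ring. \<open>cl_tensor \<D> P\<close> is the tensor product of the modules on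
  \<open>CL n\<^sub>i\<close> for \<open>i = 1, \<dots>, m\<close>.\<close>

definition cl_tensor :: "disc_config \<Rightarrow> point set \<Rightarrow> (cl_class list \<Rightarrow>\<^sub>0 laurent) set" where
  "cl_tensor \<D> P =
     {\<xi>. \<forall>cs\<in>Poly_Mapping.keys \<xi>. length cs = num_discs \<D> \<and>
           (\<forall>i\<in>{1..num_discs \<D>}. cs ! (i - 1) \<in> CL (half_points \<D> P i))}"

definition conj_cl :: "(cl_class \<Rightarrow>\<^sub>0 laurent) \<Rightarrow> (cl_class \<Rightarrow>\<^sub>0 laurent)" where
  "conj_cl = semilinear_ext reverse_cl"

definition conj_tensor :: "(cl_class list \<Rightarrow>\<^sub>0 laurent) \<Rightarrow> (cl_class list \<Rightarrow>\<^sub>0 laurent)" where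
  "conj_tensor = semilinear_ext (map reverse_cl)"

section \<open>Weights and partition maps\<close>

definition meet_number :: "disc_config \<Rightarrow> point set \<Rightarrow> nat" where
  "meet_number \<D> K = card {i. i \<le> num_discs \<D> \<and> K \<inter> frontier_S2 (disc \<D> i) \<noteq> {}}"

definition weight :: "disc_config \<Rightarrow> mcleaved \<Rightarrow> laurent" where
  "weight \<D> =
     (\<lambda>(M, \<sigma>).
        (\<Prod>K\<in>{K \<in> components M. \<sigma> K = Plus}. qhalf (2 - int (meet_number \<D> K))) *
        (\<Prod>K\<in>{K \<in> components M. \<sigma> K = Minus}. qhalf (int (meet_number \<D> K) - 2)))"

definition weight_class :: "disc_config \<Rightarrow> mcleaved set \<Rightarrow> laurent" where
  "weight_class \<D> c = the_elem (weight \<D> ` c)"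

text \<open>The sum is finite: up to the equivalence, an element of \<open>MCL \<D> P\<close> is given by crossingless
  matchings of the points of \<open>P\<close> in the complementary discs, together with a decoration.\<close>

definition partition_map ::
  "disc_config \<Rightarrow> point set \<Rightarrow> (cl_class list \<Rightarrow>\<^sub>0 laurent) \<Rightarrow> (cl_class \<Rightarrow>\<^sub>0 laurent)" where
  "partition_map \<D> P =
     linear_ext (\<lambda>cs.
       \<Sum>c\<in>{c \<in> MCL \<D> P. \<forall>i\<in>{1..num_discs \<D>}. boundary_class \<D> i c = cs ! (i - 1)}.
         Poly_Mapping.single (boundary_class \<D> 0 c) (weight_class \<D> c))"

end

theory Submission
  imports Defs
begin

text \<open>Both properties say that a symmetry of the index set of the sum defining the partition map acts on
each summand in a controlled way.

Conjugation: reversing all decorations is an involution on the decorated multiply cleaved links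
over \<open>P\<close>. It reverses the decorations of all boundaries and exchanges the exponents
\<open>1 - N/2\<close> and \<open>-1 + N/2\<close> in the weight, that is, it applies \<open>q \<mapsto> 1/q\<close> to the weight.
Reindexing the sum along this involution gives the claim on basis tensors, and semilinearity gives
the rest (\<open>partition_coeffs_reverse\<close>, \<open>partition_map_conj\<close>).

Temperley-Lieb: a circle \<open>K\<close> of \<open>P\<close> in the interior of the planar surface is a component of every
multiply cleaved link \<open>M\<close> over \<open>P\<close>. Hence \<open>M\<close> with its decoration is the same as
\<open>M - K\<close> with its decoration together with a sign for \<open>K\<close>, and this identification respects
equivalence (\<open>add_circle_map_bij\<close>). As \<open>K\<close> meets none of the boundary circles, it does not occur
in any boundary and contributes \<open>q\<close> or \<open>1/q\<close> to the weight, according to its sign. Summing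
over the two signs yields the factor \<open>q + 1/q\<close>.

The bulk of the argument is that boundaries and weights of equivalence classes are those of any
representative, since the equivalence of multiply cleaved links asks for a diffeomorphism \<open>f\<close> of
the sphere that is only known to be the identity on the planar surface, while cleaved links are
compared by orientation-preserving diffeomorphisms that map inside discs to inside discs. So one needs:

  \<^item> \<open>f\<close> maps every disc of the configuration to itself (\<open>image_disc\<close>). By invariance of domain
    the interior of a disc is connected and dense in the disc. Its image is connected, avoids the planar
    surface and has a point of the boundary circle in its closure, so it lies in the same interior.

  \<^item> \<open>f\<close> preserves the orientation (\<open>orientation_preserving_if_fixes_Sig\<close>). The orientation
    behaviour is the sign of the Jacobian determinant of the radial extension of \<open>f\<close>, which is
    continuous and nowhere zero on the connected sphere, and it is \<open>1\<close> where \<open>f\<close> is the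
    identity on an open set.

  \<^item> The relations between links are symmetric and transitive, which comes down to composing and inverting
    diffeomorphisms (\<open>k_smooth_on_compose\<close>, \<open>jacobian_compose\<close>).\<close>

section \<open>Laurent polynomials and free modules\<close>

lemma lookup_laurent_conj: "Poly_Mapping.lookup (laurent_conj p) k = Poly_Mapping.lookup p (- k)"
  by (simp add: laurent_conj_def map_key.rep_eq)

lemma laurent_conj_zero [simp]: "laurent_conj 0 = 0"
  by (rule poly_mapping_eqI) (simp add: lookup_laurent_conj)

lemma laurent_conj_one [simp]: "laurent_conj 1 = 1"
  by (rule poly_mapping_eqI) (simp add: lookup_laurent_conj lookup_one)

lemma laurent_conj_add: "laurent_conj (p + r) = laurent_conj p + laurent_conj r"
  by (rule poly_mapping_eqI) (simp add: lookup_laurent_conj lookup_add)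

lemma laurent_conj_single [simp]:
  "laurent_conj (Poly_Mapping.single k a) = Poly_Mapping.single (- k) a"
  by (rule poly_mapping_eqI) (auto simp add: lookup_laurent_conj lookup_single when_def)

lemma laurent_conj_qhalf [simp]: "laurent_conj (qhalf k) = qhalf (- k)"
  by (simp add: qhalf_def)

lemma laurent_conj_sum: "laurent_conj (sum g A) = (\<Sum>x\<in>A. laurent_conj (g x))"
  by (induction A rule: infinite_finite_induct) (auto simp: laurent_conj_add)

text \<open>Additive maps are determined by their values on single terms. This expansion reduces identities such
as multiplicativity of the conjugation to single terms.\<close>

lemma poly_mapping_as_sum:
  "(\<Sum>k\<in>Poly_Mapping.keys p. Poly_Mapping.single k (Poly_Mapping.lookup p k)) = p"
  by (rule poly_mapping_eqI)
    (simp add: lookup_sum lookup_single when_def in_keys_iff)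

lemma laurent_conj_mult: "laurent_conj (p * r) = laurent_conj p * laurent_conj r"
proof -
  let ?S = "\<lambda>p. \<Sum>k\<in>Poly_Mapping.keys p. Poly_Mapping.single k (Poly_Mapping.lookup p k)"
  have "laurent_conj (p * r) = laurent_conj (?S p * ?S r)"
    by (simp only: poly_mapping_as_sum)
  also have "\<dots> = laurent_conj (?S p) * laurent_conj (?S r)"
    by (simp add: laurent_conj_sum sum_product mult_single)
  also have "\<dots> = laurent_conj p * laurent_conj r"
    by (simp only: poly_mapping_as_sum)
  finally show ?thesis .
qed

lemma laurent_conj_prod: "laurent_conj (prod g A) = (\<Prod>x\<in>A. laurent_conj (g x))"
  by (induction A rule: infinite_finite_induct) (auto simp: laurent_conj_mult)

lemma lookup_lscale: "Poly_Mapping.lookup (lscale p \<xi>) b = p * Poly_Mapping.lookup \<xi> b"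
  by (simp add: lscale_def map.rep_eq when_def)

lemma lscale_zero [simp]: "lscale 0 \<xi> = 0" "lscale p 0 = 0"
  by (rule poly_mapping_eqI, simp add: lookup_lscale)+

lemma lscale_add_left: "lscale (p + r) \<xi> = lscale p \<xi> + lscale r \<xi>"
  by (rule poly_mapping_eqI) (simp add: lookup_lscale lookup_add algebra_simps)

lemma lscale_add: "lscale p (\<xi> + \<eta>) = lscale p \<xi> + lscale p \<eta>"
  by (rule poly_mapping_eqI) (simp add: lookup_lscale lookup_add algebra_simps)

lemma lscale_sum: "lscale p (sum g A) = (\<Sum>x\<in>A. lscale p (g x))"
  by (induction A rule: infinite_finite_induct) (auto simp: lscale_add)

lemma lscale_lscale: "lscale p (lscale r \<xi>) = lscale (p * r) \<xi>"
  by (rule poly_mapping_eqI) (simp add: lookup_lscale algebra_simps)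

lemma lscale_single: "lscale p (Poly_Mapping.single b r) = Poly_Mapping.single b (p * r)"
  by (rule poly_mapping_eqI) (simp add: lookup_lscale lookup_single when_def)

lemma linear_ext_add: "linear_ext f (\<xi> + \<eta>) = linear_ext f \<xi> + linear_ext f \<eta>"
  unfolding linear_ext_def
  by (rule setsum_keys_plus_distrib) (auto simp: lscale_add_left)

lemma linear_ext_zero [simp]: "linear_ext f 0 = 0"
  by (simp add: linear_ext_def)

lemma linear_ext_sum: "linear_ext f (sum g A) = (\<Sum>x\<in>A. linear_ext f (g x))"
  by (induction A rule: infinite_finite_induct) (auto simp: linear_ext_add)

lemma linear_ext_single [simp]: "linear_ext f (Poly_Mapping.single b p) = lscale p (f b)"
  by (simp add: linear_ext_def)

lemma linear_ext_lscale:
  assumes "\<And>b. b \<in> Poly_Mapping.keys \<xi> \<Longrightarrow> f b = lscale r (g b)"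
  shows "linear_ext f \<xi> = lscale r (linear_ext g \<xi>)"
  using assms by (simp add: linear_ext_def lscale_sum lscale_lscale mult.commute)

lemma semilinear_ext_add:
  "semilinear_ext f (\<xi> + \<eta>) = semilinear_ext f \<xi> + semilinear_ext f \<eta>"
  unfolding semilinear_ext_def
  by (rule setsum_keys_plus_distrib) (auto simp: laurent_conj_add single_add)

lemma semilinear_ext_zero [simp]: "semilinear_ext f 0 = 0"
  by (simp add: semilinear_ext_def)

lemma semilinear_ext_sum: "semilinear_ext f (sum g A) = (\<Sum>x\<in>A. semilinear_ext f (g x))"
  by (induction A rule: infinite_finite_induct) (auto simp: semilinear_ext_add)

lemma semilinear_ext_single [simp]:
  "semilinear_ext f (Poly_Mapping.single b p) = Poly_Mapping.single (f b) (laurent_conj p)"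
  by (simp add: semilinear_ext_def)

lemma semilinear_ext_lscale:
  "semilinear_ext f (lscale p \<xi>) = lscale (laurent_conj p) (semilinear_ext f \<xi>)"
proof -
  have "lscale p \<xi> = (\<Sum>b\<in>Poly_Mapping.keys \<xi>.
      Poly_Mapping.single b (p * Poly_Mapping.lookup \<xi> b))"
    by (subst poly_mapping_as_sum[of \<xi>, symmetric]) (simp only: lscale_sum lscale_single)
  then show ?thesis
    by (simp add: semilinear_ext_sum semilinear_ext_def[of f \<xi>] lscale_sum lscale_single
        laurent_conj_mult)
qed

text \<open>This reduces the conjugation property to basis tensors.\<close>

lemma linear_ext_semilinear_ext:
  assumes "\<And>b. b \<in> Poly_Mapping.keys \<xi> \<Longrightarrow> F (r b) = semilinear_ext s (F b)"
  shows "linear_ext F (semilinear_ext r \<xi>) = semilinear_ext s (linear_ext F \<xi>)"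
  using assms
  by (simp add: semilinear_ext_def[of r] linear_ext_def[of F \<xi>] linear_ext_sum
      semilinear_ext_sum semilinear_ext_lscale)

lemma keys_semilinear_ext: "Poly_Mapping.keys (semilinear_ext r \<xi>) \<subseteq> r ` Poly_Mapping.keys \<xi>"
  unfolding semilinear_ext_def
  by (rule order_trans[OF keys_sum]) (auto split: if_splits)

section \<open>Calculus of smooth maps and diffeomorphisms\<close>

lemma k_smooth_on_subset:
  "k_smooth_on k U f \<Longrightarrow> V \<subseteq> U \<Longrightarrow> k_smooth_on k V f"
proof (induction k arbitrary: f)
  case 0
  then show ?case by (auto intro: continuous_on_subset)
next
  case (Suc k)
  then show ?case by auto
qed

lemma k_smooth_on_Suc_imp: "k_smooth_on (Suc k) U f \<Longrightarrow> k_smooth_on k U f"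
proof (induction k arbitrary: f)
  case 0
  then show ?case
    by (auto intro!: differentiable_imp_continuous_on
        simp: differentiable_on_def differentiable_at_withinI)
next
  case (Suc k)
  show ?case
    unfolding k_smooth_on.simps(2)[of k]
  proof (intro conjI allI)
    show "\<forall>x\<in>U. f differentiable at x"
      using Suc.prems by simp
    show "k_smooth_on k U (\<lambda>x. frechet_derivative f (at x) v)" for v
      using Suc.prems unfolding k_smooth_on.simps(2)[of "Suc k"] by (intro Suc.IH) blast
  qed
qed

text \<open>The derivative depends only on the germ, so that formulas for derivatives may be used on open sets
inside the recursion that defines \<open>C\<^sup>k\<close> maps.\<close>

lemma has_derivative_cong_open:
  fixes f g :: "'a::real_normed_vector \<Rightarrow> 'b::real_normed_vector"
  assumes "open U" "x \<in> U" "\<And>y. y \<in> U \<Longrightarrow> f y = g y"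
  shows "(f has_derivative D) (at x) = (g has_derivative D) (at x)"
proof (rule iffI)
  assume "(f has_derivative D) (at x)"
  then show "(g has_derivative D) (at x)"
    by (rule has_derivative_transform_within_open[where s = U, OF _ assms(1,2)]) (rule assms(3))
next
  assume "(g has_derivative D) (at x)"
  then show "(f has_derivative D) (at x)"
    by (rule has_derivative_transform_within_open[where s = U, OF _ assms(1,2)]) (rule assms(3)[symmetric])
qed

lemma frechet_derivative_cong_open:
  fixes f g :: "'a::real_normed_vector \<Rightarrow> 'b::real_normed_vector"
  assumes "open U" "x \<in> U" "\<And>y. y \<in> U \<Longrightarrow> f y = g y"
  shows "frechet_derivative f (at x) = frechet_derivative g (at x)"
proof -
  have "(\<lambda>D. (f has_derivative D) (at x)) = (\<lambda>D. (g has_derivative D) (at x))"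
    by (rule ext, rule has_derivative_cong_open[OF assms(1,2)]) (rule assms(3))
  then show ?thesis
    unfolding frechet_derivative_def by (rule arg_cong)
qed

lemma k_smooth_on_cong:
  assumes "open U" and "\<And>y. y \<in> U \<Longrightarrow> f y = g y" and "k_smooth_on k U f"
  shows "k_smooth_on k U g"
  using assms(2,3)
proof (induction k arbitrary: f g)
  case 0
  then show ?case by (simp cong: continuous_on_cong)
next
  case (Suc k)
  have D: "frechet_derivative f (at x) v = frechet_derivative g (at x) v" if "x \<in> U" for x v
    by (rule fun_cong[OF frechet_derivative_cong_open[OF assms(1) that]]) (rule Suc.prems(1))
  have "g differentiable at x" if "x \<in> U" for x
  proof -
    have "(f has_derivative D) (at x) = (g has_derivative D) (at x)" for D
      by (rule has_derivative_cong_open[OF assms(1) that]) (rule Suc.prems(1))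
    moreover have "f differentiable at x"
      using Suc.prems(2) that by simp
    ultimately show ?thesis
      by (simp add: differentiable_def)
  qed
  moreover have "k_smooth_on k U (\<lambda>x. frechet_derivative g (at x) v)" for v
  proof (rule Suc.IH)
    show "k_smooth_on k U (\<lambda>x. frechet_derivative f (at x) v)"
      using Suc.prems(2) by simp
    show "frechet_derivative f (at y) v = frechet_derivative g (at y) v" if "y \<in> U" for y
      by (rule D[OF that])
  qed
  ultimately show ?case by simp
qed

text \<open>Smoothness is defined through the chosen derivative \<open>frechet_derivative\<close>; this form
accepts any explicit formula for the derivative.\<close>

lemma k_smooth_on_SucI:
  assumes "open U" "\<And>x. x \<in> U \<Longrightarrow> (f has_derivative D x) (at x)"
    "\<And>v. k_smooth_on k U (\<lambda>x. D x v)"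
  shows "k_smooth_on (Suc k) U f"
proof -
  have "k_smooth_on k U (\<lambda>x. frechet_derivative f (at x) v)" for v
    by (rule k_smooth_on_cong[OF assms(1) _ assms(3)[of v]])
      (simp add: frechet_derivative_at[OF assms(2), symmetric])
  moreover have "f differentiable at x" if "x \<in> U" for x
    by (rule differentiableI[OF assms(2)[OF that]])
  ultimately show ?thesis
    by simp
qed

lemma k_smooth_on_SucD:
  assumes "k_smooth_on (Suc k) U f"
  shows "x \<in> U \<Longrightarrow> (f has_derivative frechet_derivative f (at x)) (at x)"
    and "k_smooth_on k U (\<lambda>x. frechet_derivative f (at x) v)"
proof -
  show "k_smooth_on k U (\<lambda>x. frechet_derivative f (at x) v)"
    using assms by simp
  show "(f has_derivative frechet_derivative f (at x)) (at x)" if "x \<in> U"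
    using assms that by (simp add: frechet_derivative_works[symmetric])
qed

lemma k_smooth_on_const: "open U \<Longrightarrow> k_smooth_on k U (\<lambda>x. c)"
proof (induction k arbitrary: c)
  case (Suc k)
  then show ?case
    by (intro k_smooth_on_SucI[where D = "\<lambda>x v. 0"]) auto
qed simp

lemma k_smooth_on_id: "open U \<Longrightarrow> k_smooth_on k U (\<lambda>x. x)"
proof (cases k)
  case (Suc l)
  assume "open U"
  then show ?thesis
    unfolding Suc by (intro k_smooth_on_SucI[where D = "\<lambda>x v. v"]) (auto intro: k_smooth_on_const)
qed simp

lemma k_smooth_on_add:
  assumes "open U"
  shows "k_smooth_on k U f \<Longrightarrow> k_smooth_on k U g \<Longrightarrow> k_smooth_on k U (\<lambda>x. f x + g x)"
proof (induction k arbitrary: f g)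
  case 0
  then show ?case by (auto intro: continuous_on_add)
next
  case (Suc k)
  note f = k_smooth_on_SucD[OF Suc.prems(1)] and g = k_smooth_on_SucD[OF Suc.prems(2)]
  show ?case
    by (rule k_smooth_on_SucI[OF assms has_derivative_add[OF f(1) g(1)]])
      (use f(2) g(2) Suc.IH in auto)
qed

lemma k_smooth_on_sum:
  assumes "open U" "\<And>i. i \<in> A \<Longrightarrow> k_smooth_on k U (f i)"
  shows "k_smooth_on k U (\<lambda>x. \<Sum>i\<in>A. f i x)"
  using assms(2)
  by (induction A rule: infinite_finite_induct)
    (simp_all add: k_smooth_on_const k_smooth_on_add assms(1))

lemma k_smooth_on_inner_const:
  assumes "open U"
  shows "k_smooth_on k U f \<Longrightarrow> k_smooth_on k U (\<lambda>x. f x \<bullet> b)"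
proof (induction k arbitrary: f)
  case 0
  then show ?case by (auto intro!: continuous_intros)
next
  case (Suc k)
  note f = k_smooth_on_SucD[OF Suc.prems]
  show ?case
    by (rule k_smooth_on_SucI[OF assms has_derivative_inner_left[OF f(1)]])
      (use f(2) Suc.IH in auto)
qed

lemma k_smooth_on_scaleR:
  fixes c :: "'a::euclidean_space \<Rightarrow> real"
  assumes "open U"
  shows "k_smooth_on k U c \<Longrightarrow> k_smooth_on k U f \<Longrightarrow> k_smooth_on k U (\<lambda>x. c x *\<^sub>R f x)"
proof (induction k arbitrary: c f)
  case 0
  then show ?case by (auto intro!: continuous_intros)
next
  case (Suc k)
  note c = k_smooth_on_SucD[OF Suc.prems(1)] and f = k_smooth_on_SucD[OF Suc.prems(2)]
  show ?case
  proof (rule k_smooth_on_SucI[OF assms])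
    fix x assume "x \<in> U"
    then show "((\<lambda>x. c x *\<^sub>R f x) has_derivative
        (\<lambda>v. c x *\<^sub>R frechet_derivative f (at x) v + frechet_derivative c (at x) v *\<^sub>R f x)) (at x)"
      by (intro has_derivative_scaleR c(1) f(1))
  next
    fix v
    show "k_smooth_on k U (\<lambda>x. c x *\<^sub>R frechet_derivative f (at x) v + frechet_derivative c (at x) v *\<^sub>R f x)"
      by (rule k_smooth_on_add[OF assms Suc.IH[OF k_smooth_on_Suc_imp[OF Suc.prems(1)] f(2)]
            Suc.IH[OF c(2) k_smooth_on_Suc_imp[OF Suc.prems(2)]]])
  qed
qed

text \<open>The chain rule, expanded in a basis, writes the derivative of the composition as a sum of products
of \<open>C\<^sup>k\<close> functions, one of them again a composition, to which the induction hypothesis applies with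
a derivative of \<open>g\<close> in place of \<open>g\<close>.\<close>

lemma k_smooth_on_compose:
  fixes f :: "'a::euclidean_space \<Rightarrow> 'b::euclidean_space"
    and g :: "'b \<Rightarrow> 'c::euclidean_space"
  assumes "open U" "open V" "f ` U \<subseteq> V"
  shows "k_smooth_on k U f \<Longrightarrow> k_smooth_on k V g \<Longrightarrow> k_smooth_on k U (\<lambda>x. g (f x))"
proof (induction k arbitrary: g)
  case 0
  then show ?case
    using continuous_on_compose2[of V g U f] assms(3) by simp
next
  case (Suc k)
  note f = k_smooth_on_SucD[OF Suc.prems(1)] and g = k_smooth_on_SucD[OF Suc.prems(2)]
  let ?D = "\<lambda>x v. \<Sum>b\<in>Basis. (frechet_derivative f (at x) v \<bullet> b) *\<^sub>R frechet_derivative g (at (f x)) b"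
  show ?case
  proof (rule k_smooth_on_SucI[OF assms(1), where D = ?D])
    fix x assume x: "x \<in> U"
    then have fx: "f x \<in> V" using assms(3) by auto
    have lin: "linear (frechet_derivative g (at (f x)))"
      using g(1)[OF fx] has_derivative_linear by blast
    have eq: "frechet_derivative g (at (f x)) w = (\<Sum>b\<in>Basis. (w \<bullet> b) *\<^sub>R frechet_derivative g (at (f x)) b)" for w
      by (subst (1) euclidean_representation[of w, symmetric])
        (simp only: linear_sum[OF lin] linear_cmul[OF lin])
    show "((\<lambda>x. g (f x)) has_derivative ?D x) (at x)"
      by (rule has_derivative_eq_rhs[OF has_derivative_compose[OF f(1)[OF x] g(1)[OF fx]]])
        (rule ext, rule eq)
  next
    fix v
    show "k_smooth_on k U (\<lambda>x. ?D x v)"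
      by (rule k_smooth_on_sum[OF assms(1)], rule k_smooth_on_scaleR[OF assms(1)],
          rule k_smooth_on_inner_const[OF assms(1) f(2)],
          rule Suc.IH[OF k_smooth_on_Suc_imp[OF Suc.prems(1)] g(2)])
  qed
qed

lemma smooth_mapE:
  assumes "smooth_map X f" "x \<in> X"
  obtains U F where "open U" "x \<in> U" "\<forall>k. k_smooth_on k U F" "\<forall>y\<in>U \<inter> X. F y = f y"
proof -
  obtain U F where "open U \<and> x \<in> U \<and> (\<forall>k. k_smooth_on k U F) \<and> (\<forall>y\<in>U \<inter> X. F y = f y)"
    using bspec[OF assms(1)[unfolded smooth_map_def] assms(2)] by (elim exE)
  then show ?thesis
    using that[of U F] by simp
qed

lemma smooth_map_transform:
  assumes "smooth_map X f" and eq: "\<And>x. x \<in> X \<Longrightarrow> f x = g x"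
  shows "smooth_map X g"
  unfolding smooth_map_def
proof
  fix x assume x: "x \<in> X"
  obtain U F where "open U" "x \<in> U" "\<forall>k. k_smooth_on k U F" "\<forall>y\<in>U \<inter> X. F y = f y"
    by (rule smooth_mapE[OF assms(1) x])
  then show "\<exists>U F. open U \<and> x \<in> U \<and> (\<forall>k. k_smooth_on k U F) \<and> (\<forall>y\<in>U \<inter> X. F y = g y)"
    using eq by (intro exI[of _ U] exI[of _ F]) simp
qed

lemma smooth_map_subset:
  assumes "smooth_map X f" "Y \<subseteq> X" shows "smooth_map Y f"
  unfolding smooth_map_def
proof
  fix x assume "x \<in> Y"
  then have x: "x \<in> X" using assms(2) by auto
  obtain U F where "open U" "x \<in> U" "\<forall>k. k_smooth_on k U F" "\<forall>y\<in>U \<inter> X. F y = f y"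
    by (rule smooth_mapE[OF assms(1) x])
  then show "\<exists>U F. open U \<and> x \<in> U \<and> (\<forall>k. k_smooth_on k U F) \<and> (\<forall>y\<in>U \<inter> Y. F y = f y)"
    using assms(2) by (intro exI[of _ U] exI[of _ F]) auto
qed

lemma smooth_map_id: "smooth_map X (\<lambda>x. x)"
  unfolding smooth_map_def
  by (intro ballI exI[of _ UNIV] exI[of _ "\<lambda>x. x"]) (simp add: k_smooth_on_id)

lemma smooth_map_imp_continuous_on:
  assumes "smooth_map X f" shows "continuous_on X f"
  unfolding continuous_on_eq_continuous_within
proof
  fix x assume x: "x \<in> X"
  obtain U F where U: "open U" "x \<in> U" "\<forall>k. k_smooth_on k U F" "\<forall>y\<in>U \<inter> X. F y = f y"
    by (rule smooth_mapE[OF assms x])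
  have "continuous_on (U \<inter> X) F"
    using U(3)[rule_format, of 0] continuous_on_subset[of U F "U \<inter> X"] by simp
  then have "continuous_on (U \<inter> X) f"
    by (rule continuous_on_cong[THEN iffD1, rotated 2]) (use U(4) in auto)
  moreover have "at x within U \<inter> X = at x within X"
    by (rule at_within_nhd[OF U(2,1)]) auto
  ultimately show "continuous (at x within X) f"
    using x U(2) unfolding continuous_on_eq_continuous_within by (metis IntI)
qed

lemma smooth_map_compose:
  assumes f: "smooth_map X f" and g: "smooth_map Y g" and im: "f ` X \<subseteq> Y"
  shows "smooth_map X (g \<circ> f)"
  unfolding smooth_map_def
proof
  fix x assume x: "x \<in> X"
  obtain U F where U: "open U" "x \<in> U" "\<forall>k. k_smooth_on k U F" "\<forall>y\<in>U \<inter> X. F y = f y"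
    by (rule smooth_mapE[OF f x])
  have fx: "f x \<in> Y" using im x by auto
  obtain V G where V: "open V" "f x \<in> V" "\<forall>k. k_smooth_on k V G" "\<forall>y\<in>V \<inter> Y. G y = g y"
    by (rule smooth_mapE[OF g fx])
  have "continuous_on U F"
    using U(3)[rule_format, of 0] by simp
  then have W: "open (U \<inter> F -` V)"
    using U(1) V(1) by (simp add: continuous_on_open_vimage Int_commute)
  have "x \<in> U \<inter> F -` V"
    using U V x by auto
  moreover have "k_smooth_on k (U \<inter> F -` V) (\<lambda>y. G (F y))" for k
    by (rule k_smooth_on_compose[OF W V(1) _ k_smooth_on_subset[OF U(3)[rule_format]] V(3)[rule_format]]) auto
  moreover have "\<forall>y\<in>U \<inter> F -` V \<inter> X. G (F y) = (g \<circ> f) y"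
    using U(4) V(4) im by auto
  ultimately show "\<exists>U F. open U \<and> x \<in> U \<and> (\<forall>k. k_smooth_on k U F) \<and> (\<forall>y\<in>U \<inter> X. F y = (g \<circ> f) y)"
    using W by (intro exI[of _ "U \<inter> F -` V"] exI[of _ "\<lambda>y. G (F y)"]) simp
qed

lemma diffeo_inv:
  assumes "diffeo X Y f" shows "diffeo Y X (inv_into X f)"
proof -
  have "smooth_map X f"
    using assms by (simp add: diffeo_def)
  then have "smooth_map X (inv_into Y (inv_into X f))"
    by (rule smooth_map_transform) (use assms in \<open>simp add: diffeo_def inv_into_inv_into_eq\<close>)
  then show ?thesis
    using assms by (simp add: diffeo_def bij_betw_inv_into)
qed

lemma diffeo_compose:
  assumes "diffeo X Y f" "diffeo Y Z g"
  shows "diffeo X Z (g \<circ> f)"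
proof -
  have f: "bij_betw f X Y" and g: "bij_betw g Y Z"
    using assms by (auto simp: diffeo_def)
  have "smooth_map Z (inv_into X f \<circ> inv_into Y g)"
    using assms g by (intro smooth_map_compose) (auto simp: diffeo_def bij_betw_def inv_into_into)
  moreover have "inv_into X (g \<circ> f) z = (inv_into X f \<circ> inv_into Y g) z" if "z \<in> Z" for z
    using inv_into_comp[of g f X z] f g that by (simp add: bij_betw_def)
  ultimately have "smooth_map Z (inv_into X (g \<circ> f))"
    using smooth_map_transform[of Z "inv_into X f \<circ> inv_into Y g" "inv_into X (g \<circ> f)"] by metis
  moreover have "smooth_map X (g \<circ> f)"
    using assms f by (intro smooth_map_compose) (auto simp: diffeo_def bij_betw_def)
  ultimately show ?thesis
    using bij_betw_trans[OF f g] by (simp add: diffeo_def)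
qed

lemma diffeo_id: "diffeo X X (\<lambda>x. x)"
proof -
  have "smooth_map X (inv_into X (\<lambda>x. x))"
    by (rule smooth_map_transform[OF smooth_map_id]) (simp add: inv_into_f_eq inj_on_def)
  then show ?thesis
    by (simp add: diffeo_def smooth_map_id bij_betw_def)
qed

lemma diffeo_imp_homeomorphism:
  assumes "diffeo X Y f" shows "homeomorphism X Y f (inv_into X f)"
proof
  have f: "bij_betw f X Y" "smooth_map X f" "smooth_map Y (inv_into X f)"
    using assms by (auto simp: diffeo_def)
  then show "continuous_on X f" "continuous_on Y (inv_into X f)"
    by (simp_all add: smooth_map_imp_continuous_on)
  show "f ` X \<subseteq> Y" "inv_into X f ` Y \<subseteq> X"
    using f(1) by (auto simp: bij_betw_def inv_into_into)
  show "inv_into X f (f x) = x" if "x \<in> X" for x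
    using f(1) that by (rule bij_betw_inv_into_left)
  show "f (inv_into X f y) = y" if "y \<in> Y" for y
    using f(1) that by (rule bij_betw_inv_into_right)
qed

section \<open>Orientation-preserving diffeomorphisms of the sphere\<close>

lemma S2_iff: "x \<in> S2 \<longleftrightarrow> norm x = 1"
  by (simp add: S2_def)

text \<open>The degree-one homogeneous extension of a map of the sphere to three-space. It replaces derivatives
on tangent planes by derivatives on a fixed vector space, and it is functorial.\<close>

definition radial :: "(point \<Rightarrow> point) \<Rightarrow> point \<Rightarrow> point" where
  "radial f y = norm y *\<^sub>R f (y /\<^sub>R norm y)"

text \<open>For a map of the sphere to itself this is the determinant of the tangent map, computed in
positive orthonormal frames, because the derivative of the radial extension at \<open>x\<close> maps the
outward normal \<open>x\<close> to the outward normal \<open>f x\<close>.\<close>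

definition jacobian :: "(point \<Rightarrow> point) \<Rightarrow> point \<Rightarrow> real" where
  "jacobian f x = det (matrix (frechet_derivative (radial f) (at x)))"

lemma radial_S2 [simp]: "x \<in> S2 \<Longrightarrow> radial f x = f x"
  by (simp add: radial_def S2_iff)

lemma radial_compose:
  assumes "g ` S2 \<subseteq> S2" shows "radial (f \<circ> g) = radial f \<circ> radial g"
proof
  fix y :: point
  show "radial (f \<circ> g) y = (radial f \<circ> radial g) y"
  proof (cases "y = 0")
    case False
    then have "norm (g (y /\<^sub>R norm y)) = 1"
      using assms by (auto simp: S2_iff image_subset_iff)
    then show ?thesis
      using False by (simp add: radial_def)
  qed (simp add: radial_def)
qed

text \<open>Radial projection pulls an open neighbourhood on the sphere back to an open cone in three-space.\<close>

lemma open_cone_over: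
  assumes "open U" "x \<in> U" "x \<in> S2"
  obtains W where "open W" "x \<in> W" "\<And>z. z \<in> W \<Longrightarrow> z \<noteq> 0 \<and> z /\<^sub>R norm z \<in> U \<inter> S2"
proof
  let ?W = "(- {0}) \<inter> (\<lambda>z::point. z /\<^sub>R norm z) -` U"
  have "continuous_on (- {0}) (\<lambda>z::point. z /\<^sub>R norm z)"
    by (intro continuous_intros) auto
  then show "open ?W"
    using assms(1) by (intro continuous_open_preimage) auto
  show "x \<in> ?W"
    using assms by (auto simp: S2_iff)
  show "z \<noteq> 0 \<and> z /\<^sub>R norm z \<in> U \<inter> S2" if "z \<in> ?W" for z
    using that by (auto simp: S2_iff)
qed

lemma has_derivative_norm_S2:
  assumes "x \<in> S2" shows "(norm has_derivative (\<lambda>v. x \<bullet> v)) (at x)"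
proof -
  have "x \<noteq> 0" "norm x = 1" using assms by (auto simp: S2_iff)
  then show ?thesis
    using has_derivative_norm[of x] by (simp add: sgn_div_norm inner_commute)
qed

lemma has_derivative_normalize:
  assumes "x \<in> S2"
  shows "((\<lambda>z. z /\<^sub>R norm z) has_derivative (\<lambda>v. v - (x \<bullet> v) *\<^sub>R x)) (at x)"
proof -
  have x: "norm x = 1" "norm x \<noteq> 0" using assms by (auto simp: S2_iff)
  show ?thesis
    by (rule has_derivative_eq_rhs[OF has_derivative_scaleR[OF
            Deriv.has_derivative_inverse[OF x(2) has_derivative_norm_S2[OF assms]] has_derivative_ident]])
      (simp add: x fun_eq_iff)
qed

text \<open>A local extension \<open>F\<close> of \<open>f\<close> need not be homogeneous. Differentiating
\<open>norm z *\<^sub>R F (z /\<^sub>R norm z)\<close> replaces the derivative of \<open>F\<close> in the normal direction by \<open>F x\<close>.\<close>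

lemma has_derivative_radial:
  assumes "open U" "x \<in> U" "x \<in> S2" "\<forall>y\<in>U \<inter> S2. F y = f y" "(F has_derivative D) (at x)"
  shows "(radial f has_derivative (\<lambda>v. D v - (x \<bullet> v) *\<^sub>R D x + (x \<bullet> v) *\<^sub>R F x)) (at x)"
proof -
  have x: "x \<noteq> 0" "norm x = 1" using assms by (auto simp: S2_iff)
  obtain W where W: "open W" "x \<in> W" "\<And>z. z \<in> W \<Longrightarrow> z \<noteq> 0 \<and> z /\<^sub>R norm z \<in> U \<inter> S2"
    using open_cone_over[OF assms(1-3)] by blast
  interpret D: bounded_linear D
    using assms(5) has_derivative_bounded_linear by blast
  have "(F has_derivative D) (at (x /\<^sub>R norm x))"
    using assms(5) x by simp
  from has_derivative_compose[OF has_derivative_normalize[OF assms(3)] this]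
  have FN: "((\<lambda>z. F (z /\<^sub>R norm z)) has_derivative (\<lambda>v. D (v - (x \<bullet> v) *\<^sub>R x))) (at x)" .
  have "((\<lambda>z. norm z *\<^sub>R F (z /\<^sub>R norm z)) has_derivative
      (\<lambda>v. D v - (x \<bullet> v) *\<^sub>R D x + (x \<bullet> v) *\<^sub>R F x)) (at x)"
    by (rule has_derivative_eq_rhs[OF has_derivative_scaleR[OF has_derivative_norm_S2[OF assms(3)] FN]])
      (simp add: x fun_eq_iff D.diff D.scaleR)
  then show ?thesis
    by (rule has_derivative_transform_within_open[OF _ W(1,2)])
      (use W(3) assms(4) in \<open>auto simp: radial_def\<close>)
qed

text \<open>A local smooth extension of \<open>f\<close> gives an explicit formula for the derivative of the radial
extension. Its continuity along the sphere is what makes the Jacobian continuous.\<close>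

lemma smooth_map_S2_extension:
  assumes "smooth_map S2 f" "x \<in> S2"
  obtains U D where "open U" "x \<in> U"
    "\<forall>y\<in>U \<inter> S2. (radial f has_derivative D y) (at y)"
    "\<forall>y\<in>U \<inter> S2. D y y = f y"
    "\<forall>v. continuous_on (U \<inter> S2) (\<lambda>y. D y v)"
proof -
  obtain U F where U: "open U" "x \<in> U" "\<forall>k. k_smooth_on k U F" "\<forall>y\<in>U \<inter> S2. F y = f y"
    by (rule smooth_mapE[OF assms])
  let ?F' = "\<lambda>y. frechet_derivative F (at y)"
  let ?D = "\<lambda>y v. ?F' y v - (y \<bullet> v) *\<^sub>R ?F' y y + (y \<bullet> v) *\<^sub>R F y"
  have F: "continuous_on U F" "\<And>y. y \<in> U \<Longrightarrow> (F has_derivative ?F' y) (at y)"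
    "\<And>v. continuous_on U (\<lambda>y. ?F' y v)"
    using U(3)[rule_format, of 0] k_smooth_on_SucD[OF U(3)[rule_format, of "Suc 0"]] by simp_all
  have "continuous_on U (\<lambda>y. \<Sum>b\<in>Basis. (y \<bullet> b) *\<^sub>R ?F' y b)"
    by (intro continuous_intros F)
  moreover have "(\<Sum>b\<in>Basis. (y \<bullet> b) *\<^sub>R ?F' y b) = ?F' y y" if "y \<in> U" for y
  proof -
    have lin: "linear (?F' y)"
      using F(2)[OF that] has_derivative_linear by blast
    \<comment> \<open>\<open>F\<close> is only known to have continuous derivatives in constant directions; the direction \<open>y\<close> is expanded in the basis.\<close>
    have "(\<Sum>b\<in>Basis. (y \<bullet> b) *\<^sub>R ?F' y b) = ?F' y (\<Sum>b\<in>Basis. (y \<bullet> b) *\<^sub>R b)"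
      by (simp only: linear_sum[OF lin] linear_cmul[OF lin])
    then show ?thesis
      by (simp only: euclidean_representation)
  qed
  ultimately have diag: "continuous_on U (\<lambda>y. ?F' y y)"
    by (simp cong: continuous_on_cong)
  have "continuous_on U (\<lambda>y. ?D y v)" for v
    by (intro continuous_intros F diag)
  then have "continuous_on (U \<inter> S2) (\<lambda>y. ?D y v)" for v
    using continuous_on_subset by blast
  moreover have "(radial f has_derivative ?D y) (at y)" if "y \<in> U \<inter> S2" for y
    using that by (intro has_derivative_radial[OF U(1) _ _ U(4)] F(2)) auto
  moreover have "?D y y = f y" if "y \<in> U \<inter> S2" for y
    using that U(4) by (simp add: S2_iff dot_square_norm)
  ultimately show ?thesis
    by (intro that[OF U(1,2), of ?D] allI ballI)
qed

lemma radial_has_derivative: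
  assumes "smooth_map S2 f" "x \<in> S2"
  shows "(radial f has_derivative frechet_derivative (radial f) (at x)) (at x)"
    and "frechet_derivative (radial f) (at x) x = f x"
proof -
  obtain U D where "open U" "x \<in> U" "\<forall>y\<in>U \<inter> S2. (radial f has_derivative D y) (at y)"
    "\<forall>y\<in>U \<inter> S2. D y y = f y" "\<forall>v. continuous_on (U \<inter> S2) (\<lambda>y. D y v)"
    by (rule smooth_map_S2_extension[OF assms])
  then have D: "(radial f has_derivative D x) (at x)" "D x x = f x"
    using assms(2) by auto
  then show "(radial f has_derivative frechet_derivative (radial f) (at x)) (at x)"
    "frechet_derivative (radial f) (at x) x = f x"
    using frechet_derivative_at[OF D(1)] by auto
qed

lemma continuous_on_jacobian:
  assumes "smooth_map S2 f"
  shows "continuous_on S2 (jacobian f)"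
  unfolding continuous_on_eq_continuous_within
proof
  fix x assume x: "x \<in> S2"
  obtain U D where U: "open U" "x \<in> U"
    "\<forall>y\<in>U \<inter> S2. (radial f has_derivative D y) (at y)"
    "\<forall>y\<in>U \<inter> S2. D y y = f y" "\<forall>v. continuous_on (U \<inter> S2) (\<lambda>y. D y v)"
    by (rule smooth_map_S2_extension[OF assms x])
  have "jacobian f y = det (matrix (D y))" if "y \<in> U \<inter> S2" for y
    using frechet_derivative_at[OF bspec[OF U(3) that]] by (simp add: jacobian_def)
  moreover have "continuous_on (U \<inter> S2) (\<lambda>y. det (matrix (D y)))"
    unfolding det_3 matrix_def by (simp, intro continuous_intros U(5)[rule_format])
  ultimately have "continuous_on (U \<inter> S2) (jacobian f)"
    using continuous_on_eq[of "U \<inter> S2" "\<lambda>y. det (matrix (D y))" "jacobian f"] by simp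
  moreover have "at x within U \<inter> S2 = at x within S2"
    by (rule at_within_nhd[OF U(2,1)]) auto
  ultimately show "continuous (at x within S2) (jacobian f)"
    using x U(2) unfolding continuous_on_eq_continuous_within by (metis IntI)
qed

text \<open>The triple product is a determinant, so it scales by the determinant of the linear map.\<close>

lemma triple_product_linear_image:
  fixes T :: "point \<Rightarrow> point"
  assumes "linear T"
  shows "T a \<bullet> cross3 (T b) (T c) = det (matrix T) * (a \<bullet> cross3 b c)"
proof -
  let ?A = "matrix T"
  have T: "T = (*v) ?A"
    using assms by (simp add: matrix_works fun_eq_iff)
  have "T a \<bullet> cross3 (T b) (T c) = a \<bullet> (transpose ?A *v cross3 (?A *v b) (?A *v c))"
    by (subst (1 2 3) T) (metis dot_lmul_matrix transpose_transpose vector_transpose_matrix)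
  then show ?thesis
    by (simp only: cross_matrix_mult inner_scaleR_right)
qed

text \<open>The derivative of \<open>f\<close> within the sphere is only unique on tangent vectors. There it agrees with that of the
radial extension: compare both along the curve through \<open>x\<close> obtained by normalising \<open>x + t *\<^sub>R u\<close>.\<close>

lemma derivative_within_S2_tangent:
  assumes "smooth_map S2 f" "x \<in> S2" "(f has_derivative f') (at x within S2)" "u \<bullet> x = 0"
  shows "f' u = frechet_derivative (radial f) (at x) u"
proof -
  let ?T = "frechet_derivative (radial f) (at x)"
  let ?\<gamma> = "\<lambda>t. (x + t *\<^sub>R u) /\<^sub>R norm (x + t *\<^sub>R u)"
  have nz: "x + t *\<^sub>R u \<noteq> 0" for t
  proof
    assume "x + t *\<^sub>R u = 0"
    then have "(x + t *\<^sub>R u) \<bullet> x = 0" by simp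
    then show False
      using assms(2,4) by (simp add: inner_add_left S2_iff dot_square_norm)
  qed
  then have S2: "?\<gamma> t \<in> S2" for t
    by (simp add: S2_iff)
  have g0: "?\<gamma> 0 = x" using assms(2) by (simp add: S2_iff)
  have "((\<lambda>t. x + t *\<^sub>R u) has_derivative (\<lambda>t. t *\<^sub>R u)) (at 0)"
    by (auto intro!: derivative_eq_intros)
  moreover have "((\<lambda>z. z /\<^sub>R norm z) has_derivative (\<lambda>v. v - (x \<bullet> v) *\<^sub>R x)) (at (x + 0 *\<^sub>R u))"
    using has_derivative_normalize[OF assms(2)] by simp
  ultimately have "(?\<gamma> has_derivative (\<lambda>t. t *\<^sub>R u - (x \<bullet> (t *\<^sub>R u)) *\<^sub>R x)) (at 0)"
    by (rule has_derivative_compose)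
  then have d\<gamma>: "(?\<gamma> has_derivative (\<lambda>t. t *\<^sub>R u)) (at 0)"
    using assms(4) by (simp add: inner_commute)
  have "(f has_derivative f') (at (?\<gamma> 0) within range ?\<gamma>)"
    using has_derivative_subset[OF assms(3), of "range ?\<gamma>"] S2 g0 by auto
  from diff_chain_within[OF d\<gamma> this]
  have 1: "(f \<circ> ?\<gamma> has_derivative f' \<circ> (\<lambda>t. t *\<^sub>R u)) (at 0)" .
  have "(radial f has_derivative ?T) (at (?\<gamma> 0))"
    using radial_has_derivative(1)[OF assms(1,2)] g0 by simp
  from diff_chain_at[OF d\<gamma> this]
  have "(radial f \<circ> ?\<gamma> has_derivative ?T \<circ> (\<lambda>t. t *\<^sub>R u)) (at 0)" .
  moreover have "radial f \<circ> ?\<gamma> = f \<circ> ?\<gamma>"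
    using S2 by (auto simp: fun_eq_iff simp del: scaleR_scaleR)
  ultimately have "f' \<circ> (\<lambda>t. t *\<^sub>R u) = ?T \<circ> (\<lambda>t. t *\<^sub>R u)"
    using has_derivative_unique[OF 1] by simp
  from fun_cong[OF this, of 1] show ?thesis by simp
qed

text \<open>With \<open>u\<close>, \<open>v\<close> tangent at \<open>x\<close>, the triple product of \<open>f x\<close> and the images of \<open>u\<close>, \<open>v\<close> is
the Jacobian times the triple product of \<open>x\<close>, \<open>u\<close>, \<open>v\<close>, since the derivative of the radial extension
maps \<open>x\<close> to \<open>f x\<close>.\<close>

lemma orientation_preserving_iff_jacobian:
  assumes "smooth_map S2 f"
  shows "orientation_preserving f \<longleftrightarrow> (\<forall>x\<in>S2. 0 < jacobian f x)"
proof -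
  let ?T = "\<lambda>x. frechet_derivative (radial f) (at x)"
  note T = radial_has_derivative[OF assms]
  have triple: "f x \<bullet> cross3 (?T x u) (?T x v) = jacobian f x * (x \<bullet> cross3 u v)"
    if "x \<in> S2" for x u v
    using triple_product_linear_image[OF has_derivative_linear[OF T(1)[OF that]], of x u v]
    by (simp only: T(2)[OF that] jacobian_def)
  show ?thesis
  proof
    assume op: "orientation_preserving f"
    show "\<forall>x\<in>S2. 0 < jacobian f x"
    proof
      fix x assume x: "x \<in> S2"
      obtain u where u: "u \<noteq> 0" "u \<bullet> x = 0"
        using orthogonal_to_vector_exists[of x] by (auto simp: orthogonal_def inner_commute)
      \<comment> \<open>\<open>u\<close> and \<open>cross3 x u\<close> form a positive tangent frame at \<open>x\<close>.\<close>
      have pos: "0 < x \<bullet> cross3 u (cross3 x u)"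
        using u x by (simp add: Lagrange inner_diff_right S2_iff dot_square_norm inner_commute)
      have "(radial f has_derivative ?T x) (at x within S2)"
        using T(1)[OF x] by (rule has_derivative_at_withinI)
      then have "(f has_derivative ?T x) (at x within S2)"
        by (rule has_derivative_transform[rotated 2]) (use x in auto)
      then have "0 < f x \<bullet> cross3 (?T x u) (?T x (cross3 x u))"
        using op x u pos unfolding orientation_preserving_def
        by (simp add: dot_cross_self)
      then show "0 < jacobian f x"
        using pos by (simp add: triple[OF x] zero_less_mult_iff)
    qed
  next
    assume pos: "\<forall>x\<in>S2. 0 < jacobian f x"
    show "orientation_preserving f"
      unfolding orientation_preserving_def
    proof (intro ballI allI impI)
      fix x f' u v
      assume x: "x \<in> S2" and f': "(f has_derivative f') (at x within S2)"
        and uv: "u \<bullet> x = 0 \<and> v \<bullet> x = 0 \<and> 0 < x \<bullet> cross3 u v"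
      have "f x \<bullet> cross3 (f' u) (f' v) = jacobian f x * (x \<bullet> cross3 u v)"
        using derivative_within_S2_tangent[OF assms x f'] uv triple[OF x] by simp
      then show "0 < f x \<bullet> cross3 (f' u) (f' v)"
        using pos x uv by simp
    qed
  qed
qed

lemma jacobian_compose:
  assumes "smooth_map S2 f" "smooth_map S2 g" "g ` S2 \<subseteq> S2" "x \<in> S2"
  shows "jacobian (f \<circ> g) x = jacobian f (g x) * jacobian g x"
proof -
  have gx: "g x \<in> S2" using assms by auto
  note df = radial_has_derivative(1)[OF assms(1) gx]
    and dg = radial_has_derivative(1)[OF assms(2,4)]
  have "(radial f has_derivative frechet_derivative (radial f) (at (g x))) (at (radial g x))"
    using df assms(4) by simp
  from diff_chain_at[OF dg this]
  have "frechet_derivative (radial (f \<circ> g)) (at x) =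
      frechet_derivative (radial f) (at (g x)) \<circ> frechet_derivative (radial g) (at x)"
    unfolding radial_compose[OF assms(3)] by (rule frechet_derivative_at[symmetric])
  then show ?thesis
    unfolding jacobian_def
    by (simp add: matrix_compose det_mul has_derivative_linear[OF df] has_derivative_linear[OF dg])
qed

lemma jacobian_eq_1:
  assumes "openin (top_of_set S2) V" "x \<in> V" "\<And>y. y \<in> V \<Longrightarrow> f y = y"
  shows "jacobian f x = 1"
proof -
  obtain U where U: "open U" "V = S2 \<inter> U"
    using assms(1) by (auto simp: openin_open)
  have x: "x \<in> U" "x \<in> S2"
    using assms(2) U by auto
  obtain W where W: "open W" "x \<in> W" "\<And>z. z \<in> W \<Longrightarrow> z \<noteq> 0 \<and> z /\<^sub>R norm z \<in> U \<inter> S2"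
    using open_cone_over[OF U(1) x] by blast
  have "(radial f has_derivative (\<lambda>v. v)) (at x)"
    by (rule has_derivative_transform_within_open[OF has_derivative_ident W(1,2)])
      (use W(3) assms(3) U(2) in \<open>auto simp: radial_def\<close>)
  then have "frechet_derivative (radial f) (at x) = id"
    by (simp add: frechet_derivative_at[symmetric] id_def)
  then show ?thesis
    by (simp add: jacobian_def)
qed

text \<open>The chain rule for the composition with the inverse; in particular the Jacobian of a
diffeomorphism has no zeros.\<close>

lemma jacobian_inv_into:
  assumes "diffeo S2 S2 f" "x \<in> S2"
  shows "jacobian (inv_into S2 f) (f x) * jacobian f x = 1"
proof -
  have f: "smooth_map S2 f" "smooth_map S2 (inv_into S2 f)" "f ` S2 \<subseteq> S2" "bij_betw f S2 S2"
    using assms by (auto simp: diffeo_def bij_betw_def)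
  have "jacobian (inv_into S2 f \<circ> f) x = 1"
    by (rule jacobian_eq_1[where V = S2]) (use assms f in \<open>auto simp: bij_betw_inv_into_left\<close>)
  then show ?thesis
    using jacobian_compose[OF f(2,1,3) assms(2)] by simp
qed

lemma orientation_preserving_compose:
  assumes "diffeo S2 S2 f" "diffeo S2 S2 g" "orientation_preserving f" "orientation_preserving g"
  shows "orientation_preserving (g \<circ> f)"
proof -
  have s: "smooth_map S2 f" "smooth_map S2 g" "smooth_map S2 (g \<circ> f)" "f ` S2 \<subseteq> S2"
    using assms(1,2) diffeo_compose[OF assms(1,2)] by (auto simp: diffeo_def bij_betw_def)
  then show ?thesis
    using assms(3,4) jacobian_compose[OF s(2,1,4)]
    by (auto simp: orientation_preserving_iff_jacobian)
qed

lemma orientation_preserving_inv_into: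
  assumes "diffeo S2 S2 f" "orientation_preserving f"
  shows "orientation_preserving (inv_into S2 f)"
proof -
  have f: "smooth_map S2 f" "smooth_map S2 (inv_into S2 f)" "bij_betw f S2 S2"
    using assms by (auto simp: diffeo_def)
  have "0 < jacobian (inv_into S2 f) y" if "y \<in> S2" for y
  proof -
    obtain x where x: "x \<in> S2" "y = f x"
      using f(3) \<open>y \<in> S2\<close> by (auto simp: bij_betw_def)
    moreover have "0 < jacobian f x"
      using assms(2) f(1) x(1) by (simp add: orientation_preserving_iff_jacobian)
    ultimately show ?thesis
      using jacobian_inv_into[OF assms(1) x(1)] zero_less_mult_pos2[of "jacobian (inv_into S2 f) (f x)" "jacobian f x"]
      by simp
  qed
  then show ?thesis
    using f(2) by (simp add: orientation_preserving_iff_jacobian)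
qed

lemma connected_S2: "connected S2"
  unfolding S2_def by (rule connected_sphere) simp

text \<open>On the connected sphere the continuous, nowhere vanishing Jacobian has constant sign, and it is
positive where the map is locally the identity.\<close>

lemma orientation_preserving_if_fixes_open:
  assumes "diffeo S2 S2 f" "openin (top_of_set S2) V" "V \<noteq> {}" "\<And>y. y \<in> V \<Longrightarrow> f y = y"
  shows "orientation_preserving f"
proof -
  have f: "smooth_map S2 f"
    using assms by (auto simp: diffeo_def)
  obtain x where x: "x \<in> V"
    using assms(3) by auto
  then have xS: "x \<in> S2"
    using openin_imp_subset[OF assms(2)] by auto
  have x1: "jacobian f x = 1"
    using jacobian_eq_1[OF assms(2) x assms(4)] by simp
  have conn: "connected (jacobian f ` S2)"
    by (rule connected_continuous_image[OF continuous_on_jacobian[OF f] connected_S2])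
  have nz: "jacobian f y \<noteq> 0" if "y \<in> S2" for y
    using jacobian_inv_into[OF assms(1) that] by auto
  have "0 < jacobian f y" if y: "y \<in> S2" for y
  proof (rule ccontr)
    assume "\<not> 0 < jacobian f y"
    then have "0 \<in> jacobian f ` S2"
      using connectedD_interval[OF conn, of "jacobian f y" "jacobian f x" 0] xS y x1 by auto
    then show False using nz by auto
  qed
  then show ?thesis
    using f by (simp add: orientation_preserving_iff_jacobian)
qed

section \<open>Discs in the sphere and diffeomorphisms fixing the planar surface\<close>

lemma interior_S2_subset: "interior_S2 D \<subseteq> D"
  by (rule interior_of_subset)

lemma connected_subset_one_of_openin:
  assumes "connected C" "openin (top_of_set S) A" "openin (top_of_set S) B" "A \<inter> B = {}"
    "C \<subseteq> S" "C \<subseteq> A \<union> B"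
  shows "C \<subseteq> A \<or> C \<subseteq> B"
proof -
  obtain U V where U: "open U" "A = S \<inter> U" and V: "open V" "B = S \<inter> V"
    using assms(2,3) unfolding openin_open by blast
  have "C \<subseteq> U \<union> V" "U \<inter> V \<inter> C = {}"
    using assms(4-6) U(2) V(2) by blast+
  then have "U \<inter> C = {} \<or> V \<inter> C = {}"
    using connectedD[OF assms(1) U(1) V(1)] by blast
  then show ?thesis
    using assms(6) U(2) V(2) by blast
qed

lemma embedded_disc_compact: "embedded_disc D \<Longrightarrow> compact D"
proof -
  assume "embedded_disc D"
  then obtain f where "diffeo (cball (0::complex) 1) D f"
    by (auto simp: embedded_disc_def)
  then have "homeomorphism (cball (0::complex) 1) D f (inv_into (cball 0 1) f)"
    by (rule diffeo_imp_homeomorphism)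
  then have "continuous_on (cball 0 1) f" "f ` cball 0 1 = D"
    unfolding homeomorphism_def by auto
  then show "compact D"
    using compact_continuous_image[of "cball 0 1" f] by simp
qed

lemma embedded_disc_subset_S2: "embedded_disc D \<Longrightarrow> D \<subseteq> S2"
  by (simp add: embedded_disc_def)

text \<open>The image \<open>B\<close> of the open unit disc is open in the sphere. Since it misses the image of the boundary
point \<open>1\<close>, stereographic projection from there turns the parametrisation into an injective continuous
map between planes, to which invariance of domain applies.\<close>

lemma embedded_disc_open_part:
  assumes "embedded_disc D"
  obtains B where "openin (top_of_set S2) B" "connected B" "B \<subseteq> D" "D \<subseteq> closure B"
proof -
  obtain f where "diffeo (cball (0::complex) 1) D f"
    using assms by (auto simp: embedded_disc_def)
  then have hom: "homeomorphism (cball (0::complex) 1) D f (inv_into (cball 0 1) f)"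
    by (rule diffeo_imp_homeomorphism)
  then have f: "continuous_on (cball 0 1) f" "f ` cball 0 1 = D" "inj_on f (cball 0 1)"
    unfolding homeomorphism_def by (blast, blast, metis inj_on_inverseI)
  have DS: "D \<subseteq> S2"
    using assms by (rule embedded_disc_subset_S2)
  let ?B = "f ` ball (0::complex) 1" and ?p = "f (1::complex)"
  have sub: "ball (0::complex) 1 \<subseteq> cball 0 1" by auto
  have pS: "?p \<in> S2"
    using f(2) DS by auto
  have pB: "?p \<notin> ?B"
  proof
    assume "?p \<in> ?B"
    then obtain z :: complex where z: "z \<in> ball 0 1" "f 1 = f z" by auto
    then have "z = 1"
      using inj_onD[OF f(3), of 1 z] by auto
    then show False using z(1) by simp
  qed
  have BS: "?B \<subseteq> S2 - {?p}"
    using f(2) DS pB sub by blast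
  let ?T = "{x::point. axis 1 1 \<bullet> x = 0}"
  have "(S2 - {?p}) homeomorphic ?T"
    using homeomorphic_punctured_sphere_hyperplane[of 1 ?p 0 "axis 1 1" 0] pS
    by (simp add: S2_def axis_eq_0_iff)
  then obtain h k where hk: "homeomorphism (S2 - {?p}) ?T h k"
    by (auto simp: homeomorphic_def)
  then have h: "h ` (S2 - {?p}) = ?T" "continuous_on (S2 - {?p}) h" "\<forall>x\<in>S2 - {?p}. k (h x) = x"
    unfolding homeomorphism_def by blast+
  have "openin (top_of_set ?T) ((h \<circ> f) ` ball 0 1)"
  proof (rule invariance_of_domain_affine_sets[where U = UNIV])
    show "openin (top_of_set UNIV) (ball (0::complex) 1)"
      by simp
    show "affine ?T" by (rule affine_hyperplane)
    show "aff_dim ?T \<le> aff_dim (UNIV :: complex set)"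
      by (simp add: aff_dim_hyperplane axis_eq_0_iff)
    show "continuous_on (ball 0 1) (h \<circ> f)"
      by (intro continuous_on_compose continuous_on_subset[OF f(1) sub] continuous_on_subset[OF h(2) BS])
    have "(h \<circ> f) ` ball 0 1 \<subseteq> h ` (S2 - {?p})"
      unfolding image_comp[symmetric] by (rule image_mono[OF BS])
    then show "h \<circ> f \<in> ball 0 1 \<rightarrow> ?T"
      unfolding h(1) by (rule image_subset_iff_funcset[THEN iffD1])
    have "inj_on h (S2 - {?p})"
      using h(3) by (intro inj_on_inverseI[of _ k]) blast
    then show "inj_on (h \<circ> f) (ball 0 1)"
      by (intro comp_inj_on inj_on_subset[OF f(3) sub] inj_on_subset[OF _ BS])
  qed auto
  then have "openin (top_of_set (S2 - {?p})) (k ` (h \<circ> f) ` ball 0 1)"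
    by (rule homeomorphism_imp_open_map[OF homeomorphism_symD[OF hk]])
  moreover have "k ` h ` ?B = ?B"
  proof -
    have "(\<lambda>x. k (h x)) ` ?B = (\<lambda>x. x) ` ?B"
      by (rule image_cong[OF refl]) (use h(3) BS in blast)
    then show ?thesis
      by (simp only: image_image)
  qed
  ultimately have "openin (top_of_set (S2 - {?p})) ?B"
    by (simp only: image_comp[symmetric])
  moreover have "openin (top_of_set S2) (S2 - {?p})"
    by (intro openin_delete openin_subtopology_self)
  ultimately have "openin (top_of_set S2) ?B"
    by (rule openin_trans)
  moreover have "connected ?B"
    by (intro connected_continuous_image continuous_on_subset[OF f(1) sub] connected_ball)
  moreover have "?B \<subseteq> D"
    using f(2) sub by auto
  moreover have "D \<subseteq> closure ?B"
    using image_closure_subset[of "ball (0::complex) 1" f "closure ?B"] f(1,2) closure_subset[of ?B] by simp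
  ultimately show ?thesis
    by (rule that)
qed

lemma embedded_disc_subset_closure_interior:
  assumes "embedded_disc D" shows "D \<subseteq> closure (interior_S2 D)"
proof -
  obtain B where B: "openin (top_of_set S2) B" "connected B" "B \<subseteq> D" "D \<subseteq> closure B"
    by (rule embedded_disc_open_part[OF assms])
  have "B \<subseteq> interior_S2 D"
    using B(3,1) by (rule interior_of_maximal)
  then show ?thesis
    using B(4) closure_mono[of B "interior_S2 D"] by blast
qed

lemma embedded_disc_connected_interior:
  assumes "embedded_disc D" shows "connected (interior_S2 D)"
proof -
  obtain B where B: "openin (top_of_set S2) B" "connected B" "B \<subseteq> D" "D \<subseteq> closure B"
    by (rule embedded_disc_open_part[OF assms])
  have "B \<subseteq> interior_S2 D"
    using B(3,1) by (rule interior_of_maximal)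
  moreover have "interior_S2 D \<subseteq> closure B"
    using B(4) interior_S2_subset[of "D"] by blast
  ultimately show ?thesis
    by (rule connected_intermediate_closure[OF B(2)])
qed

lemma embedded_disc_frontier:
  assumes "embedded_disc D" shows "frontier_S2 D = D - interior_S2 D"
proof -
  have "closedin (top_of_set S2) D"
    using assms embedded_disc_subset_S2 embedded_disc_compact compact_imp_closed
    by (intro closed_subset) auto
  from closure_of_closedin[OF this] show ?thesis
    by (simp only: frontier_of_def)
qed

text \<open>The interior is dense in the disc, so an open set cannot touch the disc only along its boundary.\<close>

lemma openin_S2_meets_interior:
  assumes "embedded_disc D" "openin (top_of_set S2) V" "x \<in> V" "x \<in> D"
  shows "V \<inter> interior_S2 D \<noteq> {}"
proof -
  obtain U where U: "open U" "V = S2 \<inter> U"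
    using assms(2) by (auto simp: openin_open)
  have "x \<in> U \<inter> closure (interior_S2 D)"
    using assms U embedded_disc_subset_closure_interior by blast
  then have "U \<inter> interior_S2 D \<noteq> {}"
    using open_Int_closure_eq_empty[OF U(1)] by blast
  moreover have "interior_S2 D \<subseteq> S2"
    using embedded_disc_subset_S2[OF assms(1)] interior_S2_subset[of "D"] by blast
  ultimately show ?thesis
    using U(2) by blast
qed

context
  fixes \<D> :: disc_config
  assumes \<D>: "disc_configuration \<D>"
begin

lemma disc_embedded: "i \<le> num_discs \<D> \<Longrightarrow> embedded_disc (disc \<D> i)"
  and mark_frontier: "i \<le> num_discs \<D> \<Longrightarrow> mark \<D> i \<in> frontier_S2 (disc \<D> i)"
  and disc_inside: "i \<in> {1..num_discs \<D>} \<Longrightarrow> disc \<D> i \<subseteq> interior_S2 (disc \<D> 0)"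
  and disc_disjoint: "i \<in> {1..num_discs \<D>} \<Longrightarrow> j \<in> {1..num_discs \<D>} \<Longrightarrow> i \<noteq> j \<Longrightarrow>
    disc \<D> i \<inter> disc \<D> j = {}"
  using \<D> unfolding disc_configuration_def by blast+

lemma frontier_disc: "i \<le> num_discs \<D> \<Longrightarrow>
  frontier_S2 (disc \<D> i) = disc \<D> i - interior_S2 (disc \<D> i)"
  by (intro embedded_disc_frontier disc_embedded)

lemma Sig_subset_S2: "Sig \<D> \<subseteq> S2"
  using embedded_disc_subset_S2[OF disc_embedded[of 0]] by (auto simp: Sig_def)

lemma frontier_disc_subset_Sig:
  assumes "i \<le> num_discs \<D>" shows "frontier_S2 (disc \<D> i) \<subseteq> Sig \<D>"
proof (cases "i = 0")
  case True
  show ?thesis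
  proof
    fix x assume "x \<in> frontier_S2 (disc \<D> i)"
    then have x: "x \<in> disc \<D> 0" "x \<notin> interior_S2 (disc \<D> 0)"
      using frontier_disc[of 0] True by auto
    moreover have "x \<notin> interior_S2 (disc \<D> j)" if "j \<in> {1..num_discs \<D>}" for j
      using disc_inside[OF that] x(2) interior_S2_subset[of "disc \<D> j"] by blast
    ultimately show "x \<in> Sig \<D>"
      by (auto simp: Sig_def)
  qed
next
  case False
  then have i: "i \<in> {1..num_discs \<D>}" using assms by auto
  show ?thesis
  proof
    fix x assume "x \<in> frontier_S2 (disc \<D> i)"
    then have x: "x \<in> disc \<D> i" "x \<notin> interior_S2 (disc \<D> i)"
      using frontier_disc[OF assms] by auto
    then have "x \<in> disc \<D> 0"
      using disc_inside[OF i] interior_S2_subset[of "disc \<D> 0"] by blast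
    moreover have "x \<notin> interior_S2 (disc \<D> j)" if "j \<in> {1..num_discs \<D>}" for j
      using disc_disjoint[OF i that] x interior_S2_subset[of "disc \<D> j"]
      by (cases "i = j") blast+
    ultimately show "x \<in> Sig \<D>"
      by (auto simp: Sig_def)
  qed
qed

lemma frontier_disc_Int_interior_Sig:
  assumes "i \<le> num_discs \<D>" shows "frontier_S2 (disc \<D> i) \<inter> interior_S2 (Sig \<D>) = {}"
proof (cases "i = 0")
  case True
  have "interior_S2 (Sig \<D>) \<subseteq> interior_S2 (disc \<D> 0)"
    by (rule interior_of_mono) (auto simp: Sig_def)
  then show ?thesis
    using frontier_disc[OF assms] True by auto
next
  case False
  then have i: "i \<in> {1..num_discs \<D>}" using assms by auto
  have "interior_S2 (Sig \<D>) \<inter> interior_S2 (disc \<D> i) = {}"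
    using i interior_S2_subset[of "Sig \<D>"] by (auto simp: Sig_def)
  then have "x \<notin> disc \<D> i" if "x \<in> interior_S2 (Sig \<D>)" for x
    using openin_S2_meets_interior[OF disc_embedded[OF assms] openin_interior_of that] by blast
  then show ?thesis
    using frontier_disc[OF assms] by auto
qed

text \<open>If the interior of the outer disc were covered by the inner discs, it would equal their union,
hence be open, closed and nonempty in the connected sphere; but it is not the whole sphere,
because it omits the marked point on the outer boundary.\<close>

lemma Sig_contains_open:
  obtains V where "openin (top_of_set S2) V" "V \<noteq> {}" "V \<subseteq> Sig \<D>"
proof -
  let ?I = "interior_S2 (disc \<D> 0)" and ?K = "\<Union>i\<in>{1..num_discs \<D>}. disc \<D> i"
  have sub: "interior_S2 (disc \<D> j) \<subseteq> disc \<D> j" for j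
    by (rule interior_S2_subset)
  have 0: "embedded_disc (disc \<D> 0)"
    by (rule disc_embedded) simp
  have "compact ?K"
    by (intro compact_UN embedded_disc_compact disc_embedded) auto
  then have K: "closedin (top_of_set S2) ?K"
    using disc_inside interior_S2_subset[of "disc \<D> 0"] embedded_disc_subset_S2[OF 0]
    by (intro closed_subset compact_imp_closed) blast+
  have KI: "?K \<subseteq> ?I"
    using disc_inside by blast
  have "?I \<noteq> {}"
    using mark_frontier[of 0] embedded_disc_subset_closure_interior[OF 0] frontier_disc[of 0] by auto
  moreover have "?I \<noteq> S2"
    using mark_frontier[of 0] frontier_disc[of 0] embedded_disc_subset_S2[OF 0] by auto
  ultimately have "?K \<noteq> ?I"
    using connected_clopen[THEN iffD1, OF connected_S2, rule_format, of ?I] K by auto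
  then have "?I - ?K \<noteq> {}"
    using KI by auto
  moreover have "openin (top_of_set S2) (?I - ?K)"
    using K by (intro openin_diff) auto
  moreover have "?I - ?K \<subseteq> Sig \<D>"
    using sub unfolding Sig_def by blast
  ultimately show ?thesis
    using that by blast
qed

lemma inv_into_fixes_Sig:
  assumes "diffeo S2 S2 f" "\<forall>x\<in>Sig \<D>. f x = x"
  shows "\<forall>x\<in>Sig \<D>. inv_into S2 f x = x"
  using assms Sig_subset_S2 by (metis bij_betw_inv_into_left diffeo_def subsetD)

text \<open>Injectivity of \<open>f\<close>: a point of \<open>B\<close> is fixed, hence it is the image of no other point.\<close>

lemma image_Int_Sig:
  assumes "diffeo S2 S2 f" "\<forall>x\<in>Sig \<D>. f x = x" "A \<subseteq> S2" "B \<subseteq> Sig \<D>"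
  shows "f ` A \<inter> B = A \<inter> B"
proof -
  have "inj_on f S2"
    using assms(1) by (auto simp: diffeo_def bij_betw_def)
  then have "x = f x" if "x \<in> A" "f x \<in> B" for x
    using that assms(2-4) Sig_subset_S2 by (metis inj_onD subsetD)
  then show ?thesis
    using assms(2,4) by force
qed

text \<open>The complement of the planar surface splits into the open inner discs and the outside of the
outer disc. The image of an inner disc is connected and avoids the planar surface, so it
lies in a single piece. This piece is the disc itself, because the fixed marked point on
its boundary is a limit of the image and is bounded away from all other pieces.\<close>

lemma image_interior_disc_subset:
  assumes f: "diffeo S2 S2 f" "\<forall>x\<in>Sig \<D>. f x = x" and i: "i \<in> {1..num_discs \<D>}"
  shows "f ` interior_S2 (disc \<D> i) \<subseteq> interior_S2 (disc \<D> i)"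
proof -
  let ?I = "\<lambda>j. interior_S2 (disc \<D> j)"
  let ?J = "{1..num_discs \<D>} - {i}"
  let ?R = "(S2 - disc \<D> 0) \<union> (\<Union>j\<in>?J. ?I j)"
  \<comment> \<open>\<open>?R\<close> is the union of the other pieces of the complement of the planar surface, and \<open>?Q\<close> a closed set containing it that avoids the disc \<open>i\<close>.\<close>
  let ?Q = "(S2 - ?I 0) \<union> (\<Union>j\<in>?J. disc \<D> j)"
  have im: "i \<le> num_discs \<D>" using i by simp
  have 0: "embedded_disc (disc \<D> 0)" by (rule disc_embedded) simp
  have sub: "?I j \<subseteq> disc \<D> j" for j
    by (rule interior_S2_subset)
  have IS: "?I i \<subseteq> S2"
    using embedded_disc_subset_S2[OF disc_embedded[OF im]] sub by blast
  have fS: "f ` S2 = S2" "continuous_on S2 f"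
    using f(1) diffeo_imp_homeomorphism[OF f(1)] unfolding homeomorphism_def by auto
  let ?C = "f ` ?I i"
  have conn: "connected ?C"
    by (intro connected_continuous_image continuous_on_subset[OF fS(2) IS]
        embedded_disc_connected_interior disc_embedded im)
  have "?C \<inter> Sig \<D> = {}"
    using image_Int_Sig[OF f IS subset_refl] i by (auto simp: Sig_def)
  moreover have CS: "?C \<subseteq> S2" using fS(1) IS by blast
  ultimately have cover: "?C \<subseteq> ?I i \<union> ?R"
    unfolding Sig_def by blast
  have closed_disc: "closedin (top_of_set S2) (disc \<D> j)" if "j \<le> num_discs \<D>" for j
    using disc_embedded[OF that] embedded_disc_subset_S2 embedded_disc_compact compact_imp_closed
    by (intro closed_subset) auto
  have "openin (top_of_set S2) (S2 - disc \<D> 0)"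
    by (intro openin_diff openin_subtopology_self closed_disc) simp
  moreover have "openin (top_of_set S2) (\<Union>j\<in>?J. ?I j)"
    by (rule openin_Union) auto
  ultimately have R: "openin (top_of_set S2) ?R"
    by (rule openin_Un)
  have "?I i \<inter> ?R = {}"
  proof -
    have "?I i \<subseteq> disc \<D> 0"
      using disc_inside[OF i] sub[of i] sub[of 0] by blast
    moreover have "?I i \<inter> ?I j = {}" if "j \<in> ?J" for j
      using disc_disjoint[OF i, of j] that sub[of i] sub[of j] by blast
    ultimately show ?thesis by blast
  qed
  then have "?C \<subseteq> ?I i \<or> ?C \<subseteq> ?R"
    using connected_subset_one_of_openin[OF conn openin_interior_of R _ CS cover] by simp
  moreover have "\<not> ?C \<subseteq> ?R"
  proof
    assume "?C \<subseteq> ?R"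
    also have "?R \<subseteq> ?Q"
      by (intro Un_mono Diff_mono UN_mono sub order_refl)
    finally have CQ: "?C \<subseteq> ?Q" .
    have "closedin (top_of_set S2) (S2 - ?I 0)"
      using closedin_diff[of "top_of_set S2" S2 "?I 0"] by simp
    moreover have "closedin (top_of_set S2) (\<Union>j\<in>?J. disc \<D> j)"
      by (intro closedin_Union) (auto intro: closed_disc)
    ultimately have "closedin (top_of_set S2) ?Q"
      by (rule closedin_Un)
    then have "closed ?Q"
      by (rule closedin_closed_trans) (simp add: S2_def)
    moreover have "closure (?I i) \<subseteq> S2"
      using closure_mono[OF IS] by (simp add: S2_def)
    ultimately have imQ: "f ` closure (?I i) \<subseteq> ?Q"
      by (intro image_closure_subset[OF continuous_on_subset[OF fS(2)] _ CQ])
    have m: "mark \<D> i \<in> closure (?I i)" "mark \<D> i \<in> Sig \<D>" "mark \<D> i \<in> disc \<D> i"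
      using mark_frontier[OF im] frontier_disc[OF im] frontier_disc_subset_Sig[OF im]
        embedded_disc_subset_closure_interior[OF disc_embedded[OF im]] by auto
    have "f (mark \<D> i) \<in> ?Q"
      using imQ m(1) by (rule subsetD[OF _ imageI])
    then have "mark \<D> i \<in> ?Q"
      using f(2) m(2) by simp
    moreover have "mark \<D> i \<in> ?I 0"
      using m(3) disc_inside[OF i] by (rule subsetD[rotated])
    moreover have "mark \<D> i \<notin> disc \<D> j" if "j \<in> ?J" for j
      using that m(3) disc_disjoint[OF i, of j] by auto
    ultimately show False by auto
  qed
  ultimately show ?thesis by simp
qed

lemma image_disc:
  assumes f: "diffeo S2 S2 f" "\<forall>x\<in>Sig \<D>. f x = x" and i: "i \<le> num_discs \<D>"
  shows "f ` disc \<D> i = disc \<D> i"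
proof -
  have fS: "bij_betw f S2 S2"
    using f(1) by (simp add: diffeo_def)
  have inner: "f ` disc \<D> j = disc \<D> j" if j: "j \<in> {1..num_discs \<D>}" for j
  proof -
    let ?I = "interior_S2 (disc \<D> j)"
    have jm: "j \<le> num_discs \<D>" using j by simp
    have "?I \<subseteq> S2"
      using embedded_disc_subset_S2[OF disc_embedded[OF jm]] interior_S2_subset[of "disc \<D> j"] by blast
    then have "f ` inv_into S2 f ` ?I = ?I"
      using fS by (intro image_inv_into_cancel) (auto simp: bij_betw_def)
    then have "f ` ?I = ?I"
      using image_interior_disc_subset[OF f j]
        image_interior_disc_subset[OF diffeo_inv[OF f(1)] inv_into_fixes_Sig[OF f] j] by blast
    moreover have "f ` frontier_S2 (disc \<D> j) = frontier_S2 (disc \<D> j)"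
      using f(2) frontier_disc_subset_Sig[OF jm] by force
    moreover have "disc \<D> j = ?I \<union> frontier_S2 (disc \<D> j)"
      using frontier_disc[OF jm] interior_S2_subset[of "disc \<D> j"] by blast
    ultimately show ?thesis
      by (metis image_Un)
  qed
  show ?thesis
  proof (cases "i = 0")
    case True
    have "disc \<D> j \<subseteq> disc \<D> 0" if "j \<in> {1..num_discs \<D>}" for j
      using disc_inside[OF that] interior_S2_subset[of "disc \<D> 0"] by blast
    moreover have "interior_S2 (disc \<D> j) \<subseteq> disc \<D> j" for j
      by (rule interior_S2_subset)
    ultimately have D0: "disc \<D> 0 = Sig \<D> \<union> (\<Union>j\<in>{1..num_discs \<D>}. disc \<D> j)"
      unfolding Sig_def by blast
    have "f ` Sig \<D> = Sig \<D>"
      using f(2) by force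
    then show ?thesis
      unfolding True by (subst (1 2) D0) (simp add: image_Un image_UN inner)
  qed (use i inner in auto)
qed

lemma orientation_preserving_if_fixes_Sig:
  assumes "diffeo S2 S2 f" "\<forall>x\<in>Sig \<D>. f x = x"
  shows "orientation_preserving f"
proof -
  obtain V where "openin (top_of_set S2) V" "V \<noteq> {}" "V \<subseteq> Sig \<D>"
    by (rule Sig_contains_open)
  then show ?thesis
    using assms by (intro orientation_preserving_if_fixes_open[of f V]) auto
qed

end

section \<open>Components and transversality of unions of circles\<close>

text \<open>Each member of a finite family of disjoint closed sets is relatively open in the union, so that no
connected subset of the union reaches beyond it.\<close>

lemma components_Union_disjoint:
  assumes "finite \<C>" and closed: "\<forall>C\<in>\<C>. closed C" and conn: "\<forall>C\<in>\<C>. connected C"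
    and ne: "\<forall>C\<in>\<C>. C \<noteq> {}" and disj: "\<forall>C\<in>\<C>. \<forall>C'\<in>\<C>. C \<noteq> C' \<longrightarrow> C \<inter> C' = {}"
  shows "components (\<Union>\<C>) = \<C>"
proof -
  have comp: "C \<in> components (\<Union>\<C>)" if C: "C \<in> \<C>" for C
    unfolding in_components_maximal
  proof (intro conjI allI impI)
    show "C \<noteq> {}" "C \<subseteq> \<Union>\<C>" "connected C"
      using C ne conn by auto
    fix T assume T: "T \<noteq> {} \<and> C \<subseteq> T \<and> T \<subseteq> \<Union>\<C> \<and> connected T"
    let ?R = "\<Union>(\<C> - {C})"
    have "closed C"
      using C closed by blast
    moreover have "closed ?R"
      using closed assms(1) by (intro closed_Union) auto
    moreover have "T \<subseteq> C \<union> ?R"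
      using T by blast
    moreover have "C \<inter> ?R = {}"
      using disj C by blast
    moreover have "C \<inter> T \<noteq> {}"
      using T ne C by blast
    ultimately have "?R \<inter> T = {}"
      using connected_closedD[of T C ?R] T by (metis inf_bot_left)
    then show "T = C"
      using T by blast
  qed
  show ?thesis
  proof
    show "\<C> \<subseteq> components (\<Union>\<C>)"
      using comp by blast
    show "components (\<Union>\<C>) \<subseteq> \<C>"
    proof
      fix B assume B: "B \<in> components (\<Union>\<C>)"
      then obtain x where "x \<in> B" "x \<in> \<Union>\<C>"
        using in_components_nonempty[OF B] in_components_subset[OF B] by blast
      then obtain C where "C \<in> \<C>" "x \<in> C" by blast
      then have "B = C"
        using components_eq[OF B comp, of C] \<open>x \<in> B\<close> by blast
      then show "B \<in> \<C>" using \<open>C \<in> \<C>\<close> by simp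
    qed
  qed
qed

lemma embedded_circle_props:
  assumes "embedded_circle K"
  shows "compact K" "connected K" "K \<noteq> {}" "K \<subseteq> S2"
proof -
  obtain f where "diffeo (sphere (0::complex) 1) K f" and sub: "K \<subseteq> S2"
    using assms by (auto simp: embedded_circle_def)
  then have "homeomorphism (sphere (0::complex) 1) K f (inv_into (sphere 0 1) f)"
    by (intro diffeo_imp_homeomorphism)
  then have f: "continuous_on (sphere (0::complex) 1) f" "f ` sphere 0 1 = K"
    unfolding homeomorphism_def by auto
  show "compact K"
    using compact_continuous_image[OF f(1)] f(2) by simp
  show "connected K"
    using connected_continuous_image[OF f(1)] connected_sphere[of "0::complex" 1] f(2) by simp
  show "K \<noteq> {}"
    using f(2) by auto
  show "K \<subseteq> S2" by (rule sub)
qed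

lemma circle_union_component:
  assumes "circle_union L" "K \<in> components L"
  shows "embedded_circle K" "closed K" "K \<subseteq> S2"
proof -
  show 1: "embedded_circle K"
    using assms by (simp add: circle_union_def)
  show "closed K" "K \<subseteq> S2"
    using compact_imp_closed[OF embedded_circle_props(1)[OF 1]] embedded_circle_props(4)[OF 1] by auto
qed

lemma circle_union_subset_S2: "circle_union L \<Longrightarrow> L \<subseteq> S2"
  using circle_union_component(3)[of L] Union_components[of L] by blast

lemma components_Union_subset:
  assumes "finite (components L)" "\<forall>K\<in>components L. closed K" "\<K> \<subseteq> components L"
  shows "components (\<Union>\<K>) = \<K>"
proof (rule components_Union_disjoint)
  show "finite \<K>" using assms(3,1) by (rule finite_subset)
  show "\<forall>C\<in>\<K>. closed C" using assms by blast
  show "\<forall>C\<in>\<K>. connected C" "\<forall>C\<in>\<K>. C \<noteq> {}"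
    using assms(3) by (metis in_components_connected subsetD, metis in_components_nonempty subsetD)
  show "\<forall>C\<in>\<K>. \<forall>C'\<in>\<K>. C \<noteq> C' \<longrightarrow> C \<inter> C' = {}"
    using assms(3) by (meson components_nonoverlap subsetD)
qed

lemma circle_union_Union_subset:
  assumes "circle_union L" "\<K> \<subseteq> components L"
  shows "components (\<Union>\<K>) = \<K>" "circle_union (\<Union>\<K>)"
proof -
  show 1: "components (\<Union>\<K>) = \<K>"
    using assms circle_union_component(2)[OF assms(1)]
    by (intro components_Union_subset) (simp_all add: circle_union_def)
  show "circle_union (\<Union>\<K>)"
    using assms finite_subset[of \<K> "components L"] unfolding circle_union_def 1 by blast
qed

lemma components_homeomorphic_image:
  assumes "homeomorphism S T f g" "L \<subseteq> S"
  shows "components (f ` L) = (`) f ` components L"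
proof -
  have step: "f ` K \<in> components (f ` L)"
    if hom: "homeomorphism S T f g" and L: "L \<subseteq> S" and K: "K \<in> components L" for f g S T L K
    unfolding in_components_maximal
  proof (intro conjI allI impI)
    have KL: "K \<subseteq> L" "connected K" "K \<noteq> {}"
      using in_components_subset[OF K] in_components_connected[OF K] in_components_nonempty[OF K] by auto
    have cont: "continuous_on S f" "continuous_on T g" "f ` S = T"
      and inv: "\<forall>x\<in>S. g (f x) = x" "\<forall>y\<in>T. f (g y) = y"
      using hom unfolding homeomorphism_def by blast+
    show "f ` K \<noteq> {}" "f ` K \<subseteq> f ` L"
      using KL by auto
    show "connected (f ` K)"
      using KL L by (intro connected_continuous_image continuous_on_subset[OF cont(1)]) auto
    fix d assume d: "d \<noteq> {} \<and> f ` K \<subseteq> d \<and> d \<subseteq> f ` L \<and> connected d"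
    have dT: "d \<subseteq> T" using d L cont(3) by blast
    have gf: "g ` f ` A = A" if "A \<subseteq> S" for A
      using that inv(1) by (simp add: image_image subset_iff cong: image_cong_simp)
    have "connected (g ` d)"
      using d dT by (intro connected_continuous_image continuous_on_subset[OF cont(2)]) auto
    moreover have "K \<subseteq> g ` d"
      using image_mono[of "f ` K" d g] gf[of K] KL L d by auto
    moreover have "g ` d \<subseteq> L"
      using image_mono[of d "f ` L" g] gf[of L] L d by auto
    ultimately have "g ` d = K"
      using K d unfolding in_components_maximal by (metis image_is_empty)
    moreover have "f ` g ` d = d"
      using dT inv(2) by (simp add: image_image subset_iff cong: image_cong_simp)
    ultimately show "d = f ` K" by simp
  qed
  have gfL: "g ` f ` L = L" and fg: "\<forall>y\<in>T. f (g y) = y" and fL: "f ` L \<subseteq> T"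
    using assms unfolding homeomorphism_def by (force simp: image_image subset_iff)+
  show ?thesis
  proof
    show "(`) f ` components L \<subseteq> components (f ` L)"
      using step[OF assms] by blast
    show "components (f ` L) \<subseteq> (`) f ` components L"
    proof
      fix B assume B: "B \<in> components (f ` L)"
      have "g ` B \<in> components L"
        using step[OF homeomorphism_symD[OF assms(1)] fL B] gfL by simp
      moreover have "f ` g ` B = B"
        using in_components_subset[OF B] fL fg by (force simp: image_image)
      ultimately show "B \<in> (`) f ` components L"
        by (metis imageI)
    qed
  qed
qed

lemma components_diffeo_S2:
  assumes "diffeo S2 S2 f" "L \<subseteq> S2"
  shows "components (f ` L) = (`) f ` components L"
  using components_homeomorphic_image[OF diffeo_imp_homeomorphism[OF assms(1)] assms(2)] .

text \<open>Only the germ of a curve matters for its velocity, so the curve may be shortened until it stays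
in the neighbourhood \<open>W\<close>.\<close>

lemma tangent_vectors_mono_local:
  assumes "open W" "x \<in> W" "W \<inter> A \<subseteq> B"
  shows "tangent_vectors A x \<subseteq> tangent_vectors B x"
proof
  fix v assume "v \<in> tangent_vectors A x"
  then obtain \<gamma> e where e: "0 < e" "smooth_map {-e<..<e} \<gamma>" "\<gamma> ` {-e<..<e} \<subseteq> A" "\<gamma> (0::real) = x"
    "(\<gamma> has_vector_derivative v) (at 0)"
    unfolding tangent_vectors_def by blast
  have "continuous_on {-e<..<e} \<gamma>"
    using e(2) by (rule smooth_map_imp_continuous_on)
  then have "open ({-e<..<e} \<inter> \<gamma> -` W)"
    using assms(1) by (intro continuous_open_preimage) auto
  moreover have "0 \<in> {-e<..<e} \<inter> \<gamma> -` W"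
    using e assms(2) by simp
  ultimately obtain d where d: "0 < d" "ball 0 d \<subseteq> {-e<..<e} \<inter> \<gamma> -` W"
    unfolding open_contains_ball by meson
  have ball: "ball (0::real) d = {-d<..<d}"
    by (auto simp: dist_real_def)
  have "smooth_map {-d<..<d} \<gamma>"
    using e(2) by (rule smooth_map_subset) (use d(2) ball in auto)
  moreover have "\<gamma> ` {-d<..<d} \<subseteq> B"
    using d(2) ball e(3) assms(3) by blast
  ultimately show "v \<in> tangent_vectors B x"
    unfolding tangent_vectors_def using d(1) e(4,5) by blast
qed

lemma tangent_vectors_local:
  assumes "open W" "x \<in> W" "W \<inter> A = W \<inter> B"
  shows "tangent_vectors A x = tangent_vectors B x"
  by (intro subset_antisym tangent_vectors_mono_local[OF assms(1,2)]) (use assms(3) in auto)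

lemma tangent_vectors_component:
  assumes "finite (components M)" "\<forall>K\<in>components M. closed K" "K \<in> components M" "x \<in> K"
  shows "tangent_vectors M x = tangent_vectors K x"
proof (rule tangent_vectors_local)
  let ?W = "- \<Union>(components M - {K})"
  show "open ?W"
    using assms(1,2) by (intro open_Compl closed_Union) auto
  show "x \<in> ?W"
    using assms(3,4) components_nonoverlap[of K M] by blast
  have "M = K \<union> \<Union>(components M - {K})"
    using assms(3) Union_components[of M] by blast
  then show "?W \<inter> M = ?W \<inter> K"
    by blast
qed

text \<open>Near one of its points a finite union of disjoint closed sets looks like the member through that point.\<close>

lemma transverse_iff_components:
  assumes "finite (components M)" "\<forall>K\<in>components M. closed K"
  shows "transverse M T \<longleftrightarrow> (\<forall>K\<in>components M. transverse K T)"
proof -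
  have M: "x \<in> M \<longleftrightarrow> (\<exists>K\<in>components M. x \<in> K)" for x
    using Union_components[of M] by blast
  show ?thesis
    unfolding transverse_def using tangent_vectors_component[OF assms] M by fastforce
qed

lemma circle_union_transverse_iff:
  "circle_union M \<Longrightarrow> transverse M T \<longleftrightarrow> (\<forall>K\<in>components M. transverse K T)"
  by (rule transverse_iff_components) (auto simp: circle_union_def intro: circle_union_component(2))

section \<open>Cleaved links, multiply cleaved links and their invariants\<close>

lemma cl_relI:
  assumes "(D, a, L, \<sigma>) \<in> cleaved_links n" "(D', a', L', \<sigma>') \<in> cleaved_links n"
    "diffeo S2 S2 f" "orientation_preserving f" "f ` D = D'" "f a = a'" "f ` L = L'"
    "\<forall>K\<in>components L. \<sigma>' (f ` K) = \<sigma> K"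
  shows "((D, a, L, \<sigma>), (D', a', L', \<sigma>')) \<in> cl_rel"
  unfolding cl_rel_def using assms by blast

lemma cl_relE:
  assumes "((D, a, L, \<sigma>), (D', a', L', \<sigma>')) \<in> cl_rel"
  obtains n f where "(D, a, L, \<sigma>) \<in> cleaved_links n" "(D', a', L', \<sigma>') \<in> cleaved_links n"
    "diffeo S2 S2 f" "orientation_preserving f" "f ` D = D'" "f a = a'" "f ` L = L'"
    "\<forall>K\<in>components L. \<sigma>' (f ` K) = \<sigma> K"
  using assms unfolding cl_rel_def by blast

lemma cleaved_links_subset_S2:
  assumes "(D, a, L, \<sigma>) \<in> cleaved_links n"
  shows "D \<subseteq> S2" "a \<in> S2" "L \<subseteq> S2"
proof -
  have D: "embedded_disc D" and a: "a \<in> frontier_S2 D" and L: "circle_union L"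
    using assms by (auto simp: cleaved_links_def)
  show DS: "D \<subseteq> S2" and "L \<subseteq> S2"
    using embedded_disc_subset_S2[OF D] circle_union_subset_S2[OF L] by auto
  show "a \<in> S2"
    using DS a embedded_disc_frontier[OF D] by auto
qed

lemma cleaved_links_index_unique:
  "x \<in> cleaved_links n \<Longrightarrow> x \<in> cleaved_links n' \<Longrightarrow> n = n'"
  by (auto simp: cleaved_links_def)

lemma diffeo_S2_inv_image:
  assumes "diffeo S2 S2 f" "A \<subseteq> S2" shows "inv_into S2 f ` f ` A = A"
  using assms by (intro inv_into_image_cancel) (auto simp: diffeo_def bij_betw_def)

text \<open>Every component of \<open>f ` L\<close> is the image of a component of \<open>L\<close>, so compatibility with decorations
passes to the inverse.\<close>

lemma decoration_inv_into:
  assumes f: "diffeo S2 S2 f" and L: "L \<subseteq> S2" and eq: "\<forall>K\<in>components L. \<sigma>' (f ` K) = \<sigma> K"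
  shows "\<forall>K\<in>components (f ` L). \<sigma> (inv_into S2 f ` K) = \<sigma>' K"
proof
  fix K' assume "K' \<in> components (f ` L)"
  then obtain K where K: "K \<in> components L" "K' = f ` K"
    using components_diffeo_S2[OF f L] by blast
  then show "\<sigma> (inv_into S2 f ` K') = \<sigma>' K'"
    using diffeo_S2_inv_image[OF f, of K] in_components_subset[OF K(1)] L eq by simp
qed

lemma decoration_compose:
  assumes f: "diffeo S2 S2 f" and L: "L \<subseteq> S2" and eq: "\<forall>K\<in>components L. \<sigma>' (f ` K) = \<sigma> K"
    and eq': "\<forall>K\<in>components (f ` L). \<sigma>'' (g ` K) = \<sigma>' K"
  shows "\<forall>K\<in>components L. \<sigma>'' ((g \<circ> f) ` K) = \<sigma> K"
  using eq eq' components_diffeo_S2[OF f L] by (simp add: image_image comp_def)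

lemma sym_cl_rel: "sym cl_rel"
proof (rule symI)
  fix x y :: cleaved assume xy: "(x, y) \<in> cl_rel"
  obtain D a L \<sigma> D' a' L' \<sigma>' where x: "x = (D, a, L, \<sigma>)" and y: "y = (D', a', L', \<sigma>')"
    using prod_cases4 by metis
  obtain n f where f: "(D, a, L, \<sigma>) \<in> cleaved_links n" "(D', a', L', \<sigma>') \<in> cleaved_links n"
    "diffeo S2 S2 f" "orientation_preserving f" "f ` D = D'" "f a = a'" "f ` L = L'"
    "\<forall>K\<in>components L. \<sigma>' (f ` K) = \<sigma> K"
    using xy unfolding x y by (rule cl_relE)
  note sub = cleaved_links_subset_S2[OF f(1)]
  have "inv_into S2 f a' = a"
    using f(3,6) sub(2) by (auto simp: diffeo_def bij_betw_inv_into_left)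
  then show "(y, x) \<in> cl_rel"
    unfolding x y
    using diffeo_S2_inv_image[OF f(3)] sub decoration_inv_into[OF f(3) sub(3) f(8)] f(5,7)
    by (intro cl_relI[OF f(2,1) diffeo_inv[OF f(3)] orientation_preserving_inv_into[OF f(3,4)]]) auto
qed

lemma trans_cl_rel: "trans cl_rel"
proof (rule transI)
  fix x y z :: cleaved assume xy: "(x, y) \<in> cl_rel" and yz: "(y, z) \<in> cl_rel"
  obtain D a L \<sigma> D' a' L' \<sigma>' D'' a'' L'' \<sigma>''
    where x: "x = (D, a, L, \<sigma>)" and y: "y = (D', a', L', \<sigma>')" and z: "z = (D'', a'', L'', \<sigma>'')"
    using prod_cases4 by metis
  obtain n f where f: "(D, a, L, \<sigma>) \<in> cleaved_links n" "(D', a', L', \<sigma>') \<in> cleaved_links n"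
    "diffeo S2 S2 f" "orientation_preserving f" "f ` D = D'" "f a = a'" "f ` L = L'"
    "\<forall>K\<in>components L. \<sigma>' (f ` K) = \<sigma> K"
    using xy unfolding x y by (rule cl_relE)
  obtain n' g where g: "(D', a', L', \<sigma>') \<in> cleaved_links n'" "(D'', a'', L'', \<sigma>'') \<in> cleaved_links n'"
    "diffeo S2 S2 g" "orientation_preserving g" "g ` D' = D''" "g a' = a''" "g ` L' = L''"
    "\<forall>K\<in>components L'. \<sigma>'' (g ` K) = \<sigma>' K"
    using yz unfolding y z by (rule cl_relE)
  have "n' = n"
    using f(2) g(1) by (rule cleaved_links_index_unique[rotated])
  then have z_n: "(D'', a'', L'', \<sigma>'') \<in> cleaved_links n"
    using g(2) by simp
  have "\<forall>K\<in>components L. \<sigma>'' ((g \<circ> f) ` K) = \<sigma> K"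
    using g(8) f(7) by (intro decoration_compose[OF f(3) cleaved_links_subset_S2(3)[OF f(1)] f(8)]) simp
  then show "(x, z) \<in> cl_rel"
    unfolding x z using f(5-7) g(5-7)
    by (intro cl_relI[OF f(1) z_n diffeo_compose[OF f(3) g(3)]
          orientation_preserving_compose[OF f(3) g(3) f(4) g(4)]]) (simp_all only: image_comp[symmetric] o_apply)
qed

lemma cl_of_eq: "(x, y) \<in> cl_rel \<Longrightarrow> cl_of x = cl_of y"
  unfolding cl_of_def using symD[OF sym_cl_rel] transD[OF trans_cl_rel] by blast

lemma mcl_relI:
  assumes "(M, \<sigma>) \<in> mcleaved_links \<D>" "(M', \<sigma>') \<in> mcleaved_links \<D>"
    "diffeo S2 S2 f" "\<forall>x\<in>Sig \<D>. f x = x" "f ` M = M'" "\<forall>K\<in>components M. \<sigma>' (f ` K) = \<sigma> K"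
  shows "((M, \<sigma>), (M', \<sigma>')) \<in> mcl_rel \<D>"
  unfolding mcl_rel_def using assms by blast

lemma mcl_relE:
  assumes "((M, \<sigma>), (M', \<sigma>')) \<in> mcl_rel \<D>"
  obtains f where "(M, \<sigma>) \<in> mcleaved_links \<D>" "(M', \<sigma>') \<in> mcleaved_links \<D>"
    "diffeo S2 S2 f" "\<forall>x\<in>Sig \<D>. f x = x" "f ` M = M'" "\<forall>K\<in>components M. \<sigma>' (f ` K) = \<sigma> K"
  using assms unfolding mcl_rel_def by blast

lemma mcleaved_links_circle_union: "(M, \<sigma>) \<in> mcleaved_links \<D> \<Longrightarrow> circle_union M"
  by (simp add: mcleaved_links_def)

lemma mcleaved_links_subset_S2: "(M, \<sigma>) \<in> mcleaved_links \<D> \<Longrightarrow> M \<subseteq> S2"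
  using circle_union_subset_S2 mcleaved_links_circle_union by blast

lemma equiv_mcl_rel:
  assumes \<D>: "disc_configuration \<D>"
  shows "equiv (mcleaved_links \<D>) (mcl_rel \<D>)"
proof (rule equivI)
  show "mcl_rel \<D> \<subseteq> mcleaved_links \<D> \<times> mcleaved_links \<D>"
    by (auto simp: mcl_rel_def)
  show "refl_on (mcleaved_links \<D>) (mcl_rel \<D>)"
  proof (rule refl_onI)
    fix x assume "x \<in> mcleaved_links \<D>"
    then show "(x, x) \<in> mcl_rel \<D>"
      by (cases x) (auto intro: mcl_relI[OF _ _ diffeo_id])
  qed
  show "sym (mcl_rel \<D>)"
  proof (rule symI)
    fix x y assume xy: "(x, y) \<in> mcl_rel \<D>"
    obtain M \<sigma> M' \<sigma>' where x: "x = (M, \<sigma>)" and y: "y = (M', \<sigma>')"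
      by (cases x, cases y)
    obtain f where f: "(M, \<sigma>) \<in> mcleaved_links \<D>" "(M', \<sigma>') \<in> mcleaved_links \<D>"
      "diffeo S2 S2 f" "\<forall>x\<in>Sig \<D>. f x = x" "f ` M = M'" "\<forall>K\<in>components M. \<sigma>' (f ` K) = \<sigma> K"
      using xy unfolding x y by (rule mcl_relE)
    note sub = mcleaved_links_subset_S2[OF f(1)]
    show "(y, x) \<in> mcl_rel \<D>"
      unfolding x y
      using diffeo_S2_inv_image[OF f(3) sub] decoration_inv_into[OF f(3) sub f(6)] f(5)
      by (intro mcl_relI[OF f(2,1) diffeo_inv[OF f(3)] inv_into_fixes_Sig[OF \<D> f(3,4)]]) auto
  qed
  show "trans (mcl_rel \<D>)"
  proof (rule transI)
    fix x y z assume xy: "(x, y) \<in> mcl_rel \<D>" and yz: "(y, z) \<in> mcl_rel \<D>"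
    obtain M \<sigma> M' \<sigma>' M'' \<sigma>'' where x: "x = (M, \<sigma>)" and y: "y = (M', \<sigma>')" and z: "z = (M'', \<sigma>'')"
      by (cases x, cases y, cases z)
    obtain f where f: "(M, \<sigma>) \<in> mcleaved_links \<D>" "(M', \<sigma>') \<in> mcleaved_links \<D>"
      "diffeo S2 S2 f" "\<forall>x\<in>Sig \<D>. f x = x" "f ` M = M'" "\<forall>K\<in>components M. \<sigma>' (f ` K) = \<sigma> K"
      using xy unfolding x y by (rule mcl_relE)
    obtain g where g: "(M', \<sigma>') \<in> mcleaved_links \<D>" "(M'', \<sigma>'') \<in> mcleaved_links \<D>"
      "diffeo S2 S2 g" "\<forall>x\<in>Sig \<D>. g x = x" "g ` M' = M''" "\<forall>K\<in>components M'. \<sigma>'' (g ` K) = \<sigma>' K"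
      using yz unfolding y z by (rule mcl_relE)
    have "\<forall>K\<in>components M. \<sigma>'' ((g \<circ> f) ` K) = \<sigma> K"
      using g(6) f(5) by (intro decoration_compose[OF f(3) mcleaved_links_subset_S2[OF f(1)] f(6)]) simp
    moreover have "\<forall>x\<in>Sig \<D>. (g \<circ> f) x = x"
      using f(4) g(4) by simp
    moreover have "(g \<circ> f) ` M = M''"
      using f(5) g(5) by (simp only: image_comp[symmetric])
    ultimately show "(x, z) \<in> mcl_rel \<D>"
      unfolding x z by (intro mcl_relI[OF f(1) g(2) diffeo_compose[OF f(3) g(3)]])
  qed
qed

context
  fixes \<D> :: disc_config
  assumes \<D>: "disc_configuration \<D>"
begin

lemma mcl_rel_Int_Sig:
  assumes "((M, \<sigma>), (M', \<sigma>')) \<in> mcl_rel \<D>"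
  shows "M' \<inter> Sig \<D> = M \<inter> Sig \<D>"
proof -
  obtain f where f: "(M, \<sigma>) \<in> mcleaved_links \<D>" "(M', \<sigma>') \<in> mcleaved_links \<D>"
    "diffeo S2 S2 f" "\<forall>x\<in>Sig \<D>. f x = x" "f ` M = M'" "\<forall>K\<in>components M. \<sigma>' (f ` K) = \<sigma> K"
    using assms by (rule mcl_relE)
  show ?thesis
    using image_Int_Sig[OF \<D> f(3,4) mcleaved_links_subset_S2[OF f(1)] subset_refl] f(5) by simp
qed

text \<open>Arcs meet the boundary circles only in their endpoints and circles do not meet them. The count of the points on
a boundary circle is thus a genuine cardinality and not the default value for infinite sets.\<close>

lemma finite_planar_diagram_Int_frontier:
  assumes "planar_diagram \<D> P" "i \<le> num_discs \<D>"
  shows "finite (P \<inter> frontier_S2 (disc \<D> i))"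
proof -
  have fin: "finite (K \<inter> frontier_S2 (disc \<D> i))" if K: "K \<in> components P" for K
  proof -
    have "proper_arc \<D> K \<or> proper_circle \<D> K"
      using assms(1) K by (simp add: planar_diagram_def)
    then show ?thesis
    proof
      assume "proper_arc \<D> K"
      then obtain f :: "real \<Rightarrow> point"
        where "K \<inter> (\<Union>i\<le>num_discs \<D>. frontier_S2 (disc \<D> i)) = {f 0, f 1}"
        unfolding proper_arc_def by blast
      then have "K \<inter> frontier_S2 (disc \<D> i) \<subseteq> {f 0, f 1}"
        using assms(2) by blast
      then show ?thesis
        using finite_subset[of _ "{f 0, f 1}"] by simp
    next
      assume "proper_circle \<D> K"
      then have "K \<inter> frontier_S2 (disc \<D> i) = {}"
        using frontier_disc_Int_interior_Sig[OF \<D> assms(2)] by (auto simp: proper_circle_def)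
      then show ?thesis by simp
    qed
  qed
  have "P \<inter> frontier_S2 (disc \<D> i) = (\<Union>K\<in>components P. K \<inter> frontier_S2 (disc \<D> i))"
    using Union_components[of P] by blast
  moreover have "finite (\<Union>K\<in>components P. K \<inter> frontier_S2 (disc \<D> i))"
    using fin assms(1) by (intro finite_UN_I) (auto simp: planar_diagram_def)
  ultimately show ?thesis
    by (simp only:)
qed

text \<open>On \<open>\<partial>D\<^sub>i\<close>, which lies in the planar surface, \<open>M\<close> and its subset consisting of
the components that meet \<open>\<partial>D\<^sub>i\<close> have the same points as \<open>P\<close>.\<close>

lemma boundary_in_cleaved_links:
  assumes "planar_diagram \<D> P" "i \<le> num_discs \<D>" and M: "(M, \<sigma>) \<in> mcleaved_links \<D>" "M \<inter> Sig \<D> = P"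
  shows "boundary \<D> i (M, \<sigma>) \<in> cleaved_links (half_points \<D> P i)"
proof -
  let ?fr = "frontier_S2 (disc \<D> i)"
  let ?K = "{K \<in> components M. K \<inter> ?fr \<noteq> {}}"
  have circ: "circle_union M"
    using M(1) by (rule mcleaved_links_circle_union)
  have L: "components (\<Union>?K) = ?K" "circle_union (\<Union>?K)"
    by (rule circle_union_Union_subset[OF circ], blast)+
  have "M \<inter> ?fr = P \<inter> ?fr"
    using frontier_disc_subset_Sig[OF \<D> assms(2)] M(2) by blast
  moreover have "\<Union>?K \<inter> ?fr = M \<inter> ?fr"
    using Union_components[of M] by blast
  ultimately have Lfr: "\<Union>?K \<inter> ?fr = P \<inter> ?fr" by simp
  have "transverse M ?fr" "mark \<D> i \<notin> M"
    using M(1) assms(2) by (auto simp: mcleaved_links_def)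
  then have "\<forall>K\<in>?K. transverse K ?fr" "mark \<D> i \<notin> \<Union>?K"
    using circle_union_transverse_iff[OF circ] in_components_subset[of _ M] by blast+
  moreover have "finite (P \<inter> ?fr)" "card (P \<inter> ?fr) = 2 * half_points \<D> P i"
    using finite_planar_diagram_Int_frontier[OF assms(1,2)] assms(1,2)
    by (auto simp: half_points_def planar_diagram_def)
  moreover have "embedded_disc (disc \<D> i)" "mark \<D> i \<in> ?fr"
    using disc_embedded[OF \<D>] mark_frontier[OF \<D>] assms(2) by auto
  ultimately show ?thesis
    unfolding boundary_def cleaved_links_def
    by (simp only: case_prod_conv mem_Collect_eq L Lfr) simp
qed

text \<open>The diffeomorphism that relates two multiply cleaved links relates their boundaries as well: it
preserves the orientation and the disc, fixes the marked point, and permutes components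
without changing their intersections with the boundary circles.\<close>

lemma boundary_mcl_rel:
  assumes P: "planar_diagram \<D> P" and i: "i \<le> num_discs \<D>"
    and xy: "((M, \<sigma>), (M', \<sigma>')) \<in> mcl_rel \<D>" and M: "M \<inter> Sig \<D> = P"
  shows "(boundary \<D> i (M, \<sigma>), boundary \<D> i (M', \<sigma>')) \<in> cl_rel"
proof -
  obtain f where f: "(M, \<sigma>) \<in> mcleaved_links \<D>" "(M', \<sigma>') \<in> mcleaved_links \<D>"
    "diffeo S2 S2 f" "\<forall>x\<in>Sig \<D>. f x = x" "f ` M = M'" "\<forall>K\<in>components M. \<sigma>' (f ` K) = \<sigma> K"
    using xy by (rule mcl_relE)
  let ?fr = "frontier_S2 (disc \<D> i)"
  let ?K = "\<lambda>M. {K \<in> components M. K \<inter> ?fr \<noteq> {}}"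
  have MS: "M \<subseteq> S2"
    using f(1) by (rule mcleaved_links_subset_S2)
  have meets: "f ` K \<inter> ?fr = K \<inter> ?fr" if "K \<in> components M" for K
    using in_components_subset[OF that] MS
    by (intro image_Int_Sig[OF \<D> f(3,4) _ frontier_disc_subset_Sig[OF \<D> i]]) auto
  have comp': "components M' = (`) f ` components M"
    using components_diffeo_S2[OF f(3) MS] f(5) by simp
  have "?K M' = (`) f ` ?K M"
    unfolding comp' using meets by auto
  then have im: "f ` \<Union>(?K M) = \<Union>(?K M')"
    by (simp only: image_Union)
  have comp: "components (\<Union>(?K M)) = ?K M"
    by (rule circle_union_Union_subset[OF mcleaved_links_circle_union[OF f(1)]]) blast
  have b: "boundary \<D> i (M, \<sigma>) \<in> cleaved_links (half_points \<D> P i)"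
    "boundary \<D> i (M', \<sigma>') \<in> cleaved_links (half_points \<D> P i)"
    using boundary_in_cleaved_links[OF P i f(1) M] boundary_in_cleaved_links[OF P i f(2)]
      mcl_rel_Int_Sig[OF xy] M by auto
  have "mark \<D> i \<in> Sig \<D>"
    using mark_frontier[OF \<D> i] frontier_disc_subset_Sig[OF \<D> i] by blast
  then have "f (mark \<D> i) = mark \<D> i"
    using f(4) by simp
  moreover have "\<forall>K\<in>components (\<Union>(?K M)). \<sigma>' (f ` K) = \<sigma> K"
    unfolding comp using f(6) by simp
  ultimately show ?thesis
    using b im image_disc[OF \<D> f(3,4) i] unfolding boundary_def case_prod_conv
    by (intro cl_relI[OF _ _ f(3) orientation_preserving_if_fixes_Sig[OF \<D> f(3,4)]])
qed

lemma weight_mcl_rel: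
  assumes xy: "((M, \<sigma>), (M', \<sigma>')) \<in> mcl_rel \<D>"
  shows "weight \<D> (M', \<sigma>') = weight \<D> (M, \<sigma>)"
proof -
  obtain f where f: "(M, \<sigma>) \<in> mcleaved_links \<D>" "(M', \<sigma>') \<in> mcleaved_links \<D>"
    "diffeo S2 S2 f" "\<forall>x\<in>Sig \<D>. f x = x" "f ` M = M'" "\<forall>K\<in>components M. \<sigma>' (f ` K) = \<sigma> K"
    using xy by (rule mcl_relE)
  have MS: "M \<subseteq> S2"
    using f(1) by (rule mcleaved_links_subset_S2)
  have KS: "K \<subseteq> S2" if "K \<in> components M" for K
    using in_components_subset[OF that] MS by blast
  have meet: "meet_number \<D> (f ` K) = meet_number \<D> K" if "K \<in> components M" for K
    unfolding meet_number_def
    using image_Int_Sig[OF \<D> f(3,4) KS[OF that] frontier_disc_subset_Sig[OF \<D>]]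
    by (intro arg_cong[of _ _ card] Collect_cong) auto
  have comp': "components M' = (`) f ` components M"
    using components_diffeo_S2[OF f(3) MS] f(5) by simp
  have sets: "{K \<in> components M'. \<sigma>' K = s} = (`) f ` {K \<in> components M. \<sigma> K = s}" for s
    unfolding comp' using f(6) by auto
  have inj: "inj_on ((`) f) {K \<in> components M. \<sigma> K = s}" for s
    using diffeo_S2_inv_image[OF f(3) KS] by (intro inj_on_inverseI[of _ "(`) (inv_into S2 f)"]) auto
  have prods: "(\<Prod>K\<in>{K \<in> components M'. \<sigma>' K = s}. g (meet_number \<D> K)) =
      (\<Prod>K\<in>{K \<in> components M. \<sigma> K = s}. g (meet_number \<D> K))" for s g
    unfolding sets by (simp add: prod.reindex[OF inj] meet)
  show ?thesis
    using prods[of "\<lambda>n. qhalf (2 - int n)" Plus] prods[of "\<lambda>n. qhalf (int n - 2)" Minus]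
    by (simp add: weight_def)
qed

text \<open>\<open>the_elem\<close> yields the value on a representative only if all representatives give the same value.\<close>

lemma the_elem_image_class:
  assumes "x \<in> c" "\<And>y. y \<in> c \<Longrightarrow> g y = g x"
  shows "the_elem (g ` c) = g x"
proof -
  have "g ` c = {g x}" using assms by blast
  then show ?thesis by simp
qed

lemma mcl_rel_refl: "x \<in> mcleaved_links \<D> \<Longrightarrow> (x, x) \<in> mcl_rel \<D>"
  using equiv_mcl_rel[OF \<D>] by (meson equiv_def refl_onD)

lemma weight_class_eq:
  assumes "(M, \<sigma>) \<in> mcleaved_links \<D>"
  shows "weight_class \<D> (mcl_rel \<D> `` {(M, \<sigma>)}) = weight \<D> (M, \<sigma>)"
  unfolding weight_class_def
proof (rule the_elem_image_class)
  show "(M, \<sigma>) \<in> mcl_rel \<D> `` {(M, \<sigma>)}"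
    using mcl_rel_refl[OF assms] by simp
  show "weight \<D> y = weight \<D> (M, \<sigma>)" if "y \<in> mcl_rel \<D> `` {(M, \<sigma>)}" for y
    using that weight_mcl_rel by (cases y) auto
qed

lemma boundary_class_eq:
  assumes "planar_diagram \<D> P" "i \<le> num_discs \<D>" "(M, \<sigma>) \<in> mcleaved_links \<D>" "M \<inter> Sig \<D> = P"
  shows "boundary_class \<D> i (mcl_rel \<D> `` {(M, \<sigma>)}) = cl_of (boundary \<D> i (M, \<sigma>))"
  unfolding boundary_class_def
proof (rule the_elem_image_class)
  show "(M, \<sigma>) \<in> mcl_rel \<D> `` {(M, \<sigma>)}"
    using mcl_rel_refl[OF assms(3)] by simp
  show "cl_of (boundary \<D> i y) = cl_of (boundary \<D> i (M, \<sigma>))" if "y \<in> mcl_rel \<D> `` {(M, \<sigma>)}" for y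
  proof (cases y)
    case (Pair M' \<sigma>')
    then show ?thesis
      using that cl_of_eq[OF boundary_mcl_rel[OF assms(1,2) _ assms(4)]] by simp
  qed
qed

end

section \<open>Reversing decorations\<close>

lemma opp_opp [simp]: "opp (opp s) = s"
  by (cases s) auto

lemma opp_eq_iff: "opp s = t \<longleftrightarrow> s = opp t"
  by (cases s; cases t) auto

lemma UNIV_sign: "(UNIV :: sign set) = {Plus, Minus}"
  using sign.exhaust by auto

text \<open>The reversal of all decorations on representatives, whereas \<open>reverse_cl\<close> acts on classes.\<close>

definition flip_cl :: "cleaved \<Rightarrow> cleaved" where
  "flip_cl = (\<lambda>(D, a, L, \<sigma>). (D, a, L, opp \<circ> \<sigma>))"

definition flip :: "mcleaved \<Rightarrow> mcleaved" where
  "flip = (\<lambda>(M, \<sigma>). (M, opp \<circ> \<sigma>))"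

lemma flip_cl_simp [simp]: "flip_cl (D, a, L, \<sigma>) = (D, a, L, opp \<circ> \<sigma>)"
  by (simp add: flip_cl_def)

lemma flip_simp [simp]: "flip (M, \<sigma>) = (M, opp \<circ> \<sigma>)"
  by (simp add: flip_def)

lemma flip_cl_flip_cl [simp]: "flip_cl (flip_cl x) = x"
  by (cases x) (simp add: comp_def)

lemma flip_flip [simp]: "flip (flip x) = x"
  by (cases x) (simp add: comp_def)

lemma reverse_cl_eq: "reverse_cl c = flip_cl ` c"
  by (simp add: reverse_cl_def flip_cl_def)

lemma reverse_cl_reverse_cl [simp]: "reverse_cl (reverse_cl c) = c"
  by (simp add: reverse_cl_eq image_image)

lemma Image_singleton_involution:
  assumes inv: "\<And>x. e (e x) = x" and R: "\<And>x y. (x, y) \<in> R \<Longrightarrow> (e x, e y) \<in> R"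
  shows "R `` {e x} = e ` (R `` {x})"
proof
  show "e ` (R `` {x}) \<subseteq> R `` {e x}"
    using R by auto
  show "R `` {e x} \<subseteq> e ` (R `` {x})"
  proof
    fix y assume "y \<in> R `` {e x}"
    then have "(x, e y) \<in> R"
      using R[of "e x" y] inv by auto
    then show "y \<in> e ` (R `` {x})"
      using inv[of y] by (metis ImageI image_eqI singletonI)
  qed
qed

lemma flip_cl_cleaved_links: "x \<in> cleaved_links n \<Longrightarrow> flip_cl x \<in> cleaved_links n"
  by (cases x) (simp add: cleaved_links_def)

lemma flip_cl_rel:
  assumes "(x, y) \<in> cl_rel" shows "(flip_cl x, flip_cl y) \<in> cl_rel"
proof -
  obtain D a L \<sigma> D' a' L' \<sigma>' where x: "x = (D, a, L, \<sigma>)" and y: "y = (D', a', L', \<sigma>')"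
    using prod_cases4 by metis
  obtain n f where f: "(D, a, L, \<sigma>) \<in> cleaved_links n" "(D', a', L', \<sigma>') \<in> cleaved_links n"
    "diffeo S2 S2 f" "orientation_preserving f" "f ` D = D'" "f a = a'" "f ` L = L'"
    "\<forall>K\<in>components L. \<sigma>' (f ` K) = \<sigma> K"
    using assms unfolding x y by (rule cl_relE)
  show ?thesis
    unfolding x y flip_cl_simp
    using flip_cl_cleaved_links[OF f(1)] flip_cl_cleaved_links[OF f(2)] f(8)
    by (intro cl_relI[OF _ _ f(3-7)]) simp_all
qed

lemma cl_of_flip: "cl_of (flip_cl x) = reverse_cl (cl_of x)"
  unfolding cl_of_def reverse_cl_eq
  by (rule Image_singleton_involution) (simp_all add: flip_cl_rel)

lemma reverse_cl_in_CL:
  assumes "c \<in> CL n" shows "reverse_cl c \<in> CL n"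
proof -
  obtain x where x: "x \<in> cleaved_links n" "c = cl_of x"
    using assms unfolding CL_def cl_of_def by (auto elim: quotientE)
  then have "reverse_cl c = cl_of (flip_cl x)"
    by (simp add: cl_of_flip)
  then show ?thesis
    unfolding CL_def cl_of_def using quotientI[OF flip_cl_cleaved_links[OF x(1)], of cl_rel] by simp
qed

lemma flip_mcleaved_links: "x \<in> mcleaved_links \<D> \<Longrightarrow> flip x \<in> mcleaved_links \<D>"
  by (cases x) (simp add: mcleaved_links_def)

lemma flip_mcl_rel:
  assumes "(x, y) \<in> mcl_rel \<D>" shows "(flip x, flip y) \<in> mcl_rel \<D>"
proof -
  obtain M \<sigma> M' \<sigma>' where x: "x = (M, \<sigma>)" and y: "y = (M', \<sigma>')"
    by (cases x, cases y)
  obtain f where f: "(M, \<sigma>) \<in> mcleaved_links \<D>" "(M', \<sigma>') \<in> mcleaved_links \<D>"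
    "diffeo S2 S2 f" "\<forall>x\<in>Sig \<D>. f x = x" "f ` M = M'" "\<forall>K\<in>components M. \<sigma>' (f ` K) = \<sigma> K"
    using assms unfolding x y by (rule mcl_relE)
  show ?thesis
    unfolding x y flip_simp
    using flip_mcleaved_links[OF f(1)] flip_mcleaved_links[OF f(2)] f(6)
    by (intro mcl_relI[OF _ _ f(3-5)]) simp_all
qed

lemma flip_mcl_class: "flip ` (mcl_rel \<D> `` {x}) = mcl_rel \<D> `` {flip x}"
  by (rule Image_singleton_involution[symmetric]) (simp_all add: flip_mcl_rel)

lemma boundary_flip: "boundary \<D> i (flip x) = flip_cl (boundary \<D> i x)"
  by (cases x) (simp add: boundary_def)

text \<open>Reversal exchanges the two products in the weight, whose exponents are opposite.\<close>

lemma weight_flip: "weight \<D> (flip x) = laurent_conj (weight \<D> x)"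
proof (cases x)
  case (Pair M \<sigma>)
  then show ?thesis
    by (simp add: weight_def laurent_conj_mult laurent_conj_prod opp_eq_iff mult.commute)
qed

text \<open>The value of the partition map on the basis tensor given by \<open>cs\<close>.\<close>

definition partition_coeffs ::
  "disc_config \<Rightarrow> point set \<Rightarrow> cl_class list \<Rightarrow> (cl_class \<Rightarrow>\<^sub>0 laurent)" where
  "partition_coeffs \<D> P cs =
     (\<Sum>c\<in>{c \<in> MCL \<D> P. \<forall>i\<in>{1..num_discs \<D>}. boundary_class \<D> i c = cs ! (i - 1)}.
        Poly_Mapping.single (boundary_class \<D> 0 c) (weight_class \<D> c))"

lemma partition_map_eq: "partition_map \<D> P = linear_ext (partition_coeffs \<D> P)"
  unfolding partition_map_def partition_coeffs_def by (rule refl)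

lemma MCL_E:
  assumes "c \<in> MCL \<D> P"
  obtains M \<sigma> where "(M, \<sigma>) \<in> mcleaved_links \<D>" "M \<inter> Sig \<D> = P" "c = mcl_rel \<D> `` {(M, \<sigma>)}"
  using assms unfolding MCL_def by (auto elim!: quotientE)

lemma MCL_I:
  assumes "(M, \<sigma>) \<in> mcleaved_links \<D>" "M \<inter> Sig \<D> = P"
  shows "mcl_rel \<D> `` {(M, \<sigma>)} \<in> MCL \<D> P"
  unfolding MCL_def using assms by (intro quotientI) simp

context
  fixes \<D> :: disc_config and P :: "point set"
  assumes \<D>: "disc_configuration \<D>" and P: "planar_diagram \<D> P"
begin

lemma flip_in_MCL:
  assumes "c \<in> MCL \<D> P" shows "flip ` c \<in> MCL \<D> P"
proof -
  obtain M \<sigma> where M: "(M, \<sigma>) \<in> mcleaved_links \<D>" "M \<inter> Sig \<D> = P" "c = mcl_rel \<D> `` {(M, \<sigma>)}"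
    using assms by (rule MCL_E)
  have "(M, opp \<circ> \<sigma>) \<in> mcleaved_links \<D>"
    using flip_mcleaved_links[OF M(1)] by simp
  from MCL_I[OF this M(2)] show ?thesis
    unfolding M(3) flip_mcl_class by simp
qed

lemma boundary_class_flip:
  assumes "c \<in> MCL \<D> P" "i \<le> num_discs \<D>"
  shows "boundary_class \<D> i (flip ` c) = reverse_cl (boundary_class \<D> i c)"
proof -
  obtain M \<sigma> where M: "(M, \<sigma>) \<in> mcleaved_links \<D>" "M \<inter> Sig \<D> = P" "c = mcl_rel \<D> `` {(M, \<sigma>)}"
    using assms(1) by (rule MCL_E)
  have M': "(M, opp \<circ> \<sigma>) \<in> mcleaved_links \<D>"
    using flip_mcleaved_links[OF M(1)] by simp
  show ?thesis
    unfolding M(3) flip_mcl_class flip_simp boundary_class_eq[OF \<D> P assms(2) M(1,2)]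
      boundary_class_eq[OF \<D> P assms(2) M' M(2)]
    using boundary_flip[of \<D> i "(M, \<sigma>)"] by (simp add: cl_of_flip)
qed

lemma weight_class_flip:
  assumes "c \<in> MCL \<D> P"
  shows "weight_class \<D> (flip ` c) = laurent_conj (weight_class \<D> c)"
proof -
  obtain M \<sigma> where M: "(M, \<sigma>) \<in> mcleaved_links \<D>" "M \<inter> Sig \<D> = P" "c = mcl_rel \<D> `` {(M, \<sigma>)}"
    using assms by (rule MCL_E)
  have M': "(M, opp \<circ> \<sigma>) \<in> mcleaved_links \<D>"
    using flip_mcleaved_links[OF M(1)] by simp
  show ?thesis
    unfolding M(3) flip_mcl_class flip_simp weight_class_eq[OF \<D> M(1)] weight_class_eq[OF \<D> M']
    using weight_flip[of \<D> "(M, \<sigma>)"] by simp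
qed

text \<open>Reversal of decorations is a bijection between the summands for \<open>cs\<close> and those for the reversed list,
and it conjugates each summand.\<close>

lemma partition_coeffs_reverse:
  assumes "length cs = num_discs \<D>"
  shows "partition_coeffs \<D> P (map reverse_cl cs) =
    semilinear_ext reverse_cl (partition_coeffs \<D> P cs)"
proof -
  let ?A = "\<lambda>cs. {c \<in> MCL \<D> P. \<forall>i\<in>{1..num_discs \<D>}. boundary_class \<D> i c = cs ! (i - 1)}"
  have step: "flip ` c \<in> ?A (map reverse_cl cs)" if "c \<in> ?A cs" "length cs = num_discs \<D>" for c cs
    using that flip_in_MCL boundary_class_flip by (auto simp: nth_map)
  have ff: "flip ` flip ` c = c" for c
    by (simp add: image_image)
  have "map reverse_cl (map reverse_cl cs) = cs"
    by (simp add: comp_def)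
  then have bij: "bij_betw ((`) flip) (?A cs) (?A (map reverse_cl cs))"
    using step[of _ cs] step[of _ "map reverse_cl cs"] assms ff
    by (intro bij_betw_byWitness[where f' = "(`) flip"]) auto
  have "semilinear_ext reverse_cl (partition_coeffs \<D> P cs) =
    (\<Sum>c\<in>?A cs. Poly_Mapping.single (boundary_class \<D> 0 (flip ` c)) (weight_class \<D> (flip ` c)))"
    unfolding partition_coeffs_def semilinear_ext_sum semilinear_ext_single
    by (rule sum.cong[OF refl]) (simp add: boundary_class_flip weight_class_flip)
  also have "\<dots> = partition_coeffs \<D> P (map reverse_cl cs)"
    unfolding partition_coeffs_def by (rule sum.reindex_bij_betw[OF bij])
  finally show ?thesis by simp
qed

lemma conj_tensor_in_cl_tensor:
  assumes "\<xi> \<in> cl_tensor \<D> P" shows "conj_tensor \<xi> \<in> cl_tensor \<D> P"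
  unfolding cl_tensor_def
proof (intro CollectI ballI)
  fix cs assume "cs \<in> Poly_Mapping.keys (conj_tensor \<xi>)"
  then obtain bs where bs: "bs \<in> Poly_Mapping.keys \<xi>" "cs = map reverse_cl bs"
    using keys_semilinear_ext[of "map reverse_cl" \<xi>] unfolding conj_tensor_def by blast
  then have "length bs = num_discs \<D>"
    "\<forall>i\<in>{1..num_discs \<D>}. bs ! (i - 1) \<in> CL (half_points \<D> P i)"
    using assms by (auto simp: cl_tensor_def)
  then show "length cs = num_discs \<D> \<and> (\<forall>i\<in>{1..num_discs \<D>}. cs ! (i - 1) \<in> CL (half_points \<D> P i))"
    unfolding bs(2) by (auto simp: nth_map reverse_cl_in_CL)
qed

lemma partition_map_conj:
  assumes "\<xi> \<in> cl_tensor \<D> P"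
  shows "partition_map \<D> P (conj_tensor \<xi>) = conj_cl (partition_map \<D> P \<xi>)"
  unfolding partition_map_eq conj_tensor_def conj_cl_def
  using assms by (intro linear_ext_semilinear_ext partition_coeffs_reverse) (simp add: cl_tensor_def)

end

section \<open>Removing a circle component\<close>

lemma proper_arc_closed:
  assumes "proper_arc \<D> K" shows "closed K"
proof -
  obtain f where "diffeo {0..1::real} K f"
    using assms unfolding proper_arc_def by blast
  then have "homeomorphism {0..1::real} K f (inv_into {0..1} f)"
    by (rule diffeo_imp_homeomorphism)
  then have "continuous_on {0..1} f" "f ` {0..1} = K"
    unfolding homeomorphism_def by auto
  then show "closed K"
    using compact_continuous_image[of "{0..1}" f] by (auto intro: compact_imp_closed)
qed

lemma planar_diagram_component_closed:
  assumes "planar_diagram \<D> P" "K \<in> components P" shows "closed K"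
proof -
  have "proper_arc \<D> K \<or> proper_circle \<D> K"
    using assms by (simp add: planar_diagram_def)
  then show ?thesis
    using proper_arc_closed compact_imp_closed[OF embedded_circle_props(1)]
    by (auto simp: proper_circle_def)
qed

text \<open>The inverse of forgetting the circle, given its sign. The decoration has to be updated at \<open>K\<close>, because decorations are
total functions and may carry an arbitrary value at \<open>K\<close>, which is not a component of \<open>N\<close>.\<close>

definition add_circle :: "point set \<Rightarrow> sign \<Rightarrow> mcleaved \<Rightarrow> mcleaved" where
  "add_circle K s = (\<lambda>(N, \<tau>). (N \<union> K, \<tau>(K := s)))"

lemma add_circle_simp [simp]: "add_circle K s (N, \<tau>) = (N \<union> K, \<tau>(K := s))"
  by (simp add: add_circle_def)

context
  fixes \<D> :: disc_config and P K :: "point set"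
  assumes \<D>: "disc_configuration \<D>" and P: "planar_diagram \<D> P"
    and K: "K \<in> components P" and circle: "embedded_circle K" and inside: "K \<subseteq> interior_S2 (Sig \<D>)"
begin

lemma circle_subset_Sig: "K \<subseteq> Sig \<D>"
  using inside interior_S2_subset[of "Sig \<D>"] by blast

lemma circle_misses_frontier: "i \<le> num_discs \<D> \<Longrightarrow> K \<inter> frontier_S2 (disc \<D> i) = {}"
  using inside frontier_disc_Int_interior_Sig[OF \<D>, of i] by blast

lemma circle_meet_number: "meet_number \<D> K = 0"
  using circle_misses_frontier by (auto simp: meet_number_def)

lemma components_remove_circle: "components (P - K) = components P - {K}"
  and closed_remove_circle: "closed (P - K)"
proof -
  have fin: "finite (components P)"
    using P by (simp add: planar_diagram_def)
  have cl: "\<forall>J\<in>components P. closed J"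
    using planar_diagram_component_closed[OF P] by blast
  have eq: "P - K = \<Union>(components P - {K})"
    using Union_components[of P] components_nonoverlap[OF K] K by blast
  show "components (P - K) = components P - {K}"
    unfolding eq by (rule components_Union_subset[OF fin cl]) blast
  show "closed (P - K)"
    unfolding eq using fin cl by (intro closed_Union) auto
qed

lemma remove_circle_Int_frontier:
  "i \<le> num_discs \<D> \<Longrightarrow> (P - K) \<inter> frontier_S2 (disc \<D> i) = P \<inter> frontier_S2 (disc \<D> i)"
  using circle_misses_frontier by blast

lemma planar_diagram_remove_circle: "planar_diagram \<D> (P - K)"
  using P remove_circle_Int_frontier
  by (auto simp: planar_diagram_def components_remove_circle)

lemma half_points_remove_circle: "i \<le> num_discs \<D> \<Longrightarrow> half_points \<D> (P - K) i = half_points \<D> P i"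
  by (simp add: half_points_def remove_circle_Int_frontier)

text \<open>Within \<open>M\<close> the circle is closed, and it is also open: inside the planar surface \<open>M\<close> coincides with \<open>P\<close>,
where \<open>K\<close> has a neighbourhood that avoids the closed set \<open>P - K\<close>.\<close>

lemma circle_is_component:
  assumes M: "M \<subseteq> S2" "M \<inter> Sig \<D> = P"
  shows "K \<in> components M"
  unfolding in_components_maximal
proof (intro conjI allI impI)
  have KP: "K \<subseteq> P" using K by (rule in_components_subset)
  show "K \<noteq> {}" "connected K" "K \<subseteq> M"
    using embedded_circle_props[OF circle] KP M(2) by auto
  fix T assume T: "T \<noteq> {} \<and> K \<subseteq> T \<and> T \<subseteq> M \<and> connected T"
  obtain U where U: "open U" "interior_S2 (Sig \<D>) = S2 \<inter> U"
    using openin_interior_of[of "top_of_set S2" "Sig \<D>"] unfolding openin_open by blast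
  let ?U = "U - (P - K)"
  have "M \<inter> U \<subseteq> P"
    using M U(2) interior_S2_subset[of "Sig \<D>"] by blast
  then have MU: "M \<inter> ?U = K"
    using KP M inside U(2) by blast
  have "open ?U"
    using U(1) closed_remove_circle by (rule open_Diff)
  moreover have "open (- K)"
    using compact_imp_closed[OF embedded_circle_props(1)[OF circle]] by (rule open_Compl)
  moreover have "T \<subseteq> ?U \<union> - K" "?U \<inter> - K \<inter> T = {}"
    using T MU by blast+
  ultimately have "?U \<inter> T = {} \<or> - K \<inter> T = {}"
    using connectedD[of T ?U "- K"] T by blast
  moreover have "?U \<inter> T \<noteq> {}"
    using T MU \<open>K \<noteq> {}\<close> by blast
  ultimately show "T = K"
    using T by blast
qed

lemma remove_circle_mcleaved_links:
  assumes M: "(M, \<sigma>) \<in> mcleaved_links \<D>" "M \<inter> Sig \<D> = P"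
  shows "(M - K, \<sigma>) \<in> mcleaved_links \<D>" "(M - K) \<inter> Sig \<D> = P - K"
    and "add_circle K (\<sigma> K) (M - K, \<sigma>) = (M, \<sigma>)"
proof -
  have circ: "circle_union M"
    using M(1) by (rule mcleaved_links_circle_union)
  have KM: "K \<in> components M"
    using mcleaved_links_subset_S2[OF M(1)] M(2) by (rule circle_is_component)
  have eq: "M - K = \<Union>(components M - {K})"
    using Union_components[of M] components_nonoverlap[OF KM] KM by blast
  have N: "components (M - K) = components M - {K}" "circle_union (M - K)"
    unfolding eq by (rule circle_union_Union_subset[OF circ], blast)+
  have "transverse (M - K) (frontier_S2 (disc \<D> i))" if "i \<le> num_discs \<D>" for i
  proof -
    have "transverse M (frontier_S2 (disc \<D> i))"
      using M(1) that by (simp add: mcleaved_links_def)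
    then show ?thesis
      unfolding circle_union_transverse_iff[OF circ] circle_union_transverse_iff[OF N(2)] N(1) by simp
  qed
  then show "(M - K, \<sigma>) \<in> mcleaved_links \<D>"
    using M(1) N by (simp add: mcleaved_links_def)
  show "(M - K) \<inter> Sig \<D> = P - K"
    using M(2) by blast
  show "add_circle K (\<sigma> K) (M - K, \<sigma>) = (M, \<sigma>)"
    using in_components_subset[OF KM] by (auto simp: Un_absorb2)
qed

lemma add_circle_components:
  assumes N: "(N, \<tau>) \<in> mcleaved_links \<D>" "N \<inter> Sig \<D> = P - K"
  shows "components (N \<union> K) = insert K (components N)" "N \<inter> K = {}" "K \<notin> components N"
    "circle_union (N \<union> K)" "finite (components N)"
proof -
  have circ: "circle_union N"
    using N(1) by (rule mcleaved_links_circle_union)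
  show NK: "N \<inter> K = {}"
    using N(2) circle_subset_Sig by blast
  show "K \<notin> components N"
    using NK embedded_circle_props(3)[OF circle] in_components_subset[of K N] by blast
  show fin: "finite (components N)"
    using circ by (simp add: circle_union_def)
  have "components (\<Union>(insert K (components N))) = insert K (components N)"
  proof (rule components_Union_disjoint)
    show "finite (insert K (components N))" using fin by simp
    have emb: "\<forall>C\<in>insert K (components N). embedded_circle C"
      using circ circle by (simp add: circle_union_def)
    then show "\<forall>C\<in>insert K (components N). closed C"
      using compact_imp_closed[OF embedded_circle_props(1)] by blast
    show "\<forall>C\<in>insert K (components N). connected C" "\<forall>C\<in>insert K (components N). C \<noteq> {}"
      using emb embedded_circle_props(2,3) by blast+
    have "J \<inter> K = {}" if "J \<in> components N" for J
      using NK in_components_subset[OF that] by blast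
    then show "\<forall>C\<in>insert K (components N). \<forall>C'\<in>insert K (components N). C \<noteq> C' \<longrightarrow> C \<inter> C' = {}"
      by (auto simp: Int_commute components_nonoverlap)
  qed
  then show comp: "components (N \<union> K) = insert K (components N)"
    by (simp add: Un_commute)
  show "circle_union (N \<union> K)"
    using circ circle by (simp add: circle_union_def comp)
qed

lemma add_circle_mcleaved_links:
  assumes N: "(N, \<tau>) \<in> mcleaved_links \<D>" "N \<inter> Sig \<D> = P - K"
  shows "(N \<union> K, \<tau>(K := s)) \<in> mcleaved_links \<D>" "(N \<union> K) \<inter> Sig \<D> = P"
proof -
  note comps = add_circle_components[OF N]
  have circ: "circle_union N"
    using N(1) by (rule mcleaved_links_circle_union)
  have "transverse (N \<union> K) (frontier_S2 (disc \<D> i))" if "i \<le> num_discs \<D>" for i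
  proof -
    have "transverse N (frontier_S2 (disc \<D> i))"
      using N(1) that by (simp add: mcleaved_links_def)
    moreover have "transverse K (frontier_S2 (disc \<D> i))"
      using circle_misses_frontier[OF that] by (simp add: transverse_def)
    ultimately show ?thesis
      unfolding circle_union_transverse_iff[OF circ] circle_union_transverse_iff[OF comps(4)] comps(1)
      by simp
  qed
  moreover have "mark \<D> i \<notin> K" if "i \<le> num_discs \<D>" for i
    using mark_frontier[OF \<D> that] circle_misses_frontier[OF that] by blast
  moreover have "\<not> K \<subseteq> S2 - disc \<D> 0" "\<forall>i\<in>{1..num_discs \<D>}. \<not> K \<subseteq> interior_S2 (disc \<D> i)"
    using circle_subset_Sig embedded_circle_props(3)[OF circle] unfolding Sig_def by blast+
  ultimately show "(N \<union> K, \<tau>(K := s)) \<in> mcleaved_links \<D>"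
    using N(1) comps(1,4) by (simp add: mcleaved_links_def)
  show "(N \<union> K) \<inter> Sig \<D> = P"
    using N(2) circle_subset_Sig in_components_subset[OF K] by blast
qed

text \<open>A diffeomorphism that fixes the planar surface maps \<open>K\<close> to itself, so it relates the links with \<open>K\<close>
exactly if it relates the links without \<open>K\<close> and the signs of \<open>K\<close> agree.\<close>

lemma add_circle_mcl_rel_iff:
  assumes N: "(N, \<tau>) \<in> mcleaved_links \<D>" "N \<inter> Sig \<D> = P - K"
    and N': "(N', \<tau>') \<in> mcleaved_links \<D>" "N' \<inter> Sig \<D> = P - K"
  shows "(add_circle K s (N, \<tau>), add_circle K t (N', \<tau>')) \<in> mcl_rel \<D> \<longleftrightarrow>
    ((N, \<tau>), (N', \<tau>')) \<in> mcl_rel \<D> \<and> s = t"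
proof -
  note c = add_circle_components[OF N] and c' = add_circle_components[OF N']
  have NS: "N \<subseteq> S2" and KS: "K \<subseteq> S2"
    using mcleaved_links_subset_S2[OF N(1)] embedded_circle_props(4)[OF circle] by auto
  have fixK: "f ` K = K" if "\<forall>x\<in>Sig \<D>. f x = x" for f :: "point \<Rightarrow> point"
    using that circle_subset_Sig by force
  have comp': "f ` J \<in> components N' \<and> f ` J \<noteq> K"
    if "diffeo S2 S2 f" "f ` N = N'" "J \<in> components N" for f J
    using components_diffeo_S2[OF that(1) NS] that(2,3) c'(3) by blast
  show ?thesis
  proof
    assume "(add_circle K s (N, \<tau>), add_circle K t (N', \<tau>')) \<in> mcl_rel \<D>"
    then obtain f where f: "diffeo S2 S2 f" "\<forall>x\<in>Sig \<D>. f x = x" "f ` (N \<union> K) = N' \<union> K"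
      "\<forall>J\<in>components (N \<union> K). (\<tau>'(K := t)) (f ` J) = (\<tau>(K := s)) J"
      unfolding add_circle_simp by (rule mcl_relE)
    have "inj_on f (N \<union> K)"
      using f(1) NS KS by (auto simp: diffeo_def bij_betw_def intro: inj_on_subset)
    then have "f ` N \<inter> K = {}"
      using inj_on_image_Int[of f "N \<union> K" N K] fixK[OF f(2)] c(2) by auto
    then have fN: "f ` N = N'"
      using f(3) fixK[OF f(2)] c'(2) unfolding image_Un by blast
    have "\<forall>J\<in>components N. \<tau>' (f ` J) = \<tau> J"
    proof
      fix J assume J: "J \<in> components N"
      then have "J \<noteq> K" using c(3) by blast
      moreover have "(\<tau>'(K := t)) (f ` J) = (\<tau>(K := s)) J"
        using J by (intro bspec[OF f(4)]) (simp add: c(1))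
      ultimately show "\<tau>' (f ` J) = \<tau> J"
        using comp'[OF f(1) fN J] by simp
    qed
    then have "((N, \<tau>), (N', \<tau>')) \<in> mcl_rel \<D>"
      by (rule mcl_relI[OF N(1) N'(1) f(1,2) fN])
    moreover have "s = t"
      using f(4) fixK[OF f(2)] by (simp add: c(1))
    ultimately show "((N, \<tau>), (N', \<tau>')) \<in> mcl_rel \<D> \<and> s = t" by simp
  next
    assume rel: "((N, \<tau>), (N', \<tau>')) \<in> mcl_rel \<D> \<and> s = t"
    then obtain f where f: "diffeo S2 S2 f" "\<forall>x\<in>Sig \<D>. f x = x" "f ` N = N'"
      "\<forall>J\<in>components N. \<tau>' (f ` J) = \<tau> J"
      by (elim conjE mcl_relE)
    have "f ` (N \<union> K) = N' \<union> K"
      using f(3) fixK[OF f(2)] by (simp only: image_Un)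
    moreover have "\<forall>J\<in>components (N \<union> K). (\<tau>'(K := s)) (f ` J) = (\<tau>(K := s)) J"
      unfolding c(1) using f(4) fixK[OF f(2)] comp'[OF f(1,3)] c(3) by auto
    ultimately show "(add_circle K s (N, \<tau>), add_circle K t (N', \<tau>')) \<in> mcl_rel \<D>"
      using add_circle_mcleaved_links[OF N] add_circle_mcleaved_links[OF N'] rel f(1,2)
      unfolding add_circle_simp by (intro mcl_relI) auto
  qed
qed

text \<open>Both boundaries have the same underlying link, which does not contain \<open>K\<close>; the decorations differ at most
at \<open>K\<close>, so the identity map relates them.\<close>

lemma add_circle_boundary:
  assumes N: "(N, \<tau>) \<in> mcleaved_links \<D>" "N \<inter> Sig \<D> = P - K" and i: "i \<le> num_discs \<D>"
  shows "cl_of (boundary \<D> i (add_circle K s (N, \<tau>))) = cl_of (boundary \<D> i (N, \<tau>))"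
proof -
  let ?fr = "frontier_S2 (disc \<D> i)"
  let ?C = "{J \<in> components N. J \<inter> ?fr \<noteq> {}}"
  note c = add_circle_components[OF N]
  have eq: "{J \<in> components (N \<union> K). J \<inter> ?fr \<noteq> {}} = ?C"
    unfolding c(1) using circle_misses_frontier[OF i] by blast
  have b: "boundary \<D> i (N, \<tau>) = (disc \<D> i, mark \<D> i, \<Union>?C, \<tau>)"
    "boundary \<D> i (add_circle K s (N, \<tau>)) = (disc \<D> i, mark \<D> i, \<Union>?C, \<tau>(K := s))"
    unfolding boundary_def add_circle_simp case_prod_conv eq by (rule refl)+
  have "boundary \<D> i (N, \<tau>) \<in> cleaved_links (half_points \<D> (P - K) i)"
    by (rule boundary_in_cleaved_links[OF \<D> planar_diagram_remove_circle i N])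
  moreover from this have "boundary \<D> i (add_circle K s (N, \<tau>)) \<in> cleaved_links (half_points \<D> (P - K) i)"
    unfolding b by (simp add: cleaved_links_def)
  moreover have "\<forall>J\<in>components (\<Union>?C). \<tau> ((\<lambda>x. x) ` J) = (\<tau>(K := s)) J"
  proof -
    have "components (\<Union>?C) = ?C"
      by (rule circle_union_Union_subset[OF mcleaved_links_circle_union[OF N(1)]]) blast
    then show ?thesis
      using c(3) by auto
  qed
  ultimately have "(boundary \<D> i (add_circle K s (N, \<tau>)), boundary \<D> i (N, \<tau>)) \<in> cl_rel"
    unfolding b
    by (intro cl_relI[OF _ _ diffeo_id orientation_preserving_if_fixes_Sig[OF \<D> diffeo_id]]) auto
  then show ?thesis
    by (rule cl_of_eq)
qed

text \<open>As \<open>K\<close> meets no boundary circle, its factor in the weight is \<open>q\<close> or \<open>1/q\<close>, and \<open>qhalf k\<close> is \<open>q\<close> to the power \<open>k/2\<close>.\<close>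

lemma add_circle_weight:
  assumes N: "(N, \<tau>) \<in> mcleaved_links \<D>" "N \<inter> Sig \<D> = P - K"
  shows "weight \<D> (add_circle K s (N, \<tau>)) =
    (case s of Plus \<Rightarrow> qhalf 2 | Minus \<Rightarrow> qhalf (- 2)) * weight \<D> (N, \<tau>)"
proof -
  note c = add_circle_components[OF N]
  let ?C = "\<lambda>s. {J \<in> components N. \<tau> J = s}"
  have sets: "{J \<in> components (N \<union> K). (\<tau>(K := s)) J = t} = (if t = s then insert K (?C t) else ?C t)" for t
    unfolding c(1) using c(3) by auto
  have "finite (?C t)" "K \<notin> ?C t" for t
    using c(3,5) by auto
  then show ?thesis
    unfolding weight_def add_circle_simp case_prod_conv sets
    by (cases s) (simp_all add: circle_meet_number mult.assoc mult.left_commute)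
qed

lemma add_circle_class:
  assumes N: "(N, \<tau>) \<in> mcleaved_links \<D>" "N \<inter> Sig \<D> = P - K"
  shows "mcl_rel \<D> `` (add_circle K s ` (mcl_rel \<D> `` {(N, \<tau>)})) = mcl_rel \<D> `` {add_circle K s (N, \<tau>)}"
proof -
  have "mcl_rel \<D> `` {add_circle K s y} = mcl_rel \<D> `` {add_circle K s (N, \<tau>)}"
    if y: "((N, \<tau>), y) \<in> mcl_rel \<D>" for y
  proof -
    obtain N' \<tau>' where y': "y = (N', \<tau>')" by (cases y)
    have "(N', \<tau>') \<in> mcleaved_links \<D>" "N' \<inter> Sig \<D> = P - K"
      using y mcl_rel_Int_Sig[OF \<D>] N(2) unfolding y' by (auto simp: mcl_rel_def)
    then have "(add_circle K s (N, \<tau>), add_circle K s y) \<in> mcl_rel \<D>"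
      using y add_circle_mcl_rel_iff[OF N] unfolding y' by blast
    then show ?thesis
      using equiv_class_eq[OF equiv_mcl_rel[OF \<D>]] by metis
  qed
  then have "mcl_rel \<D> `` {add_circle K s y} = mcl_rel \<D> `` {add_circle K s (N, \<tau>)}"
    if "y \<in> mcl_rel \<D> `` {(N, \<tau>)}" for y
    using that by simp
  moreover have "(N, \<tau>) \<in> mcl_rel \<D> `` {(N, \<tau>)}"
    using mcl_rel_refl[OF \<D> N(1)] by simp
  moreover have "mcl_rel \<D> `` (add_circle K s ` (mcl_rel \<D> `` {(N, \<tau>)})) =
      (\<Union>y\<in>mcl_rel \<D> `` {(N, \<tau>)}. mcl_rel \<D> `` {add_circle K s y})"
    by auto
  ultimately show ?thesis
    by (metis (no_types, lifting) SUP_eq_const empty_iff)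
qed

definition add_circle_map :: "mcleaved set \<times> sign \<Rightarrow> mcleaved set" where
  "add_circle_map = (\<lambda>(c, s). mcl_rel \<D> `` (add_circle K s ` c))"

text \<open>Injectivity and compatibility with classes come from \<open>add_circle_mcl_rel_iff\<close>; surjectivity holds on
representatives already, as every link over \<open>P\<close> is recovered by adding back its circle \<open>K\<close>.\<close>

lemma add_circle_map_bij: "bij_betw add_circle_map (MCL \<D> (P - K) \<times> UNIV) (MCL \<D> P)"
  unfolding bij_betw_def
proof
  show "inj_on add_circle_map (MCL \<D> (P - K) \<times> UNIV)"
  proof (rule inj_onI)
    fix x y assume x: "x \<in> MCL \<D> (P - K) \<times> UNIV" and y: "y \<in> MCL \<D> (P - K) \<times> UNIV"
      and eq: "add_circle_map x = add_circle_map y"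
    obtain c s c' t where cs: "x = (c, s)" "y = (c', t)" by (cases x, cases y)
    obtain N \<tau> where N: "(N, \<tau>) \<in> mcleaved_links \<D>" "N \<inter> Sig \<D> = P - K" "c = mcl_rel \<D> `` {(N, \<tau>)}"
      using x cs by (auto elim: MCL_E)
    obtain N' \<tau>' where N': "(N', \<tau>') \<in> mcleaved_links \<D>" "N' \<inter> Sig \<D> = P - K"
      "c' = mcl_rel \<D> `` {(N', \<tau>')}"
      using y cs by (auto elim: MCL_E)
    have "mcl_rel \<D> `` {add_circle K s (N, \<tau>)} = mcl_rel \<D> `` {add_circle K t (N', \<tau>')}"
      using eq unfolding cs add_circle_map_def case_prod_conv N(3) N'(3)
        add_circle_class[OF N(1,2)] add_circle_class[OF N'(1,2)] .
    moreover have "add_circle K t (N', \<tau>') \<in> mcleaved_links \<D>"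
      using add_circle_mcleaved_links(1)[OF N'(1,2)] by simp
    ultimately have "(add_circle K s (N, \<tau>), add_circle K t (N', \<tau>')) \<in> mcl_rel \<D>"
      by (rule eq_equiv_class[OF _ equiv_mcl_rel[OF \<D>]])
    then have "((N, \<tau>), (N', \<tau>')) \<in> mcl_rel \<D>" "s = t"
      using add_circle_mcl_rel_iff[OF N(1,2) N'(1,2)] by auto
    then show "x = y"
      unfolding cs N(3) N'(3) using equiv_class_eq[OF equiv_mcl_rel[OF \<D>]] by simp
  qed
  show "add_circle_map ` (MCL \<D> (P - K) \<times> UNIV) = MCL \<D> P"
  proof
    show "add_circle_map ` (MCL \<D> (P - K) \<times> UNIV) \<subseteq> MCL \<D> P"
    proof (rule image_subsetI)
      fix x assume x: "x \<in> MCL \<D> (P - K) \<times> (UNIV :: sign set)"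
      obtain c s where cs: "x = (c, s)" by (cases x)
      obtain N \<tau> where N: "(N, \<tau>) \<in> mcleaved_links \<D>" "N \<inter> Sig \<D> = P - K" "c = mcl_rel \<D> `` {(N, \<tau>)}"
        using x cs by (auto elim: MCL_E)
      show "add_circle_map x \<in> MCL \<D> P"
        unfolding cs add_circle_map_def case_prod_conv N(3) add_circle_class[OF N(1,2)] add_circle_simp
        by (rule MCL_I[OF add_circle_mcleaved_links[OF N(1,2)]])
    qed
    show "MCL \<D> P \<subseteq> add_circle_map ` (MCL \<D> (P - K) \<times> UNIV)"
    proof
      fix c assume "c \<in> MCL \<D> P"
      then obtain M \<sigma> where M: "(M, \<sigma>) \<in> mcleaved_links \<D>" "M \<inter> Sig \<D> = P" "c = mcl_rel \<D> `` {(M, \<sigma>)}"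
        by (rule MCL_E)
      note N = remove_circle_mcleaved_links[OF M(1,2)]
      have "add_circle_map (mcl_rel \<D> `` {(M - K, \<sigma>)}, \<sigma> K) = c"
        unfolding add_circle_map_def case_prod_conv add_circle_class[OF N(1,2)] N(3) M(3) by (rule refl)
      then show "c \<in> add_circle_map ` (MCL \<D> (P - K) \<times> UNIV)"
        using MCL_I[OF N(1,2)] by (intro image_eqI[of _ _ "(mcl_rel \<D> `` {(M - K, \<sigma>)}, \<sigma> K)"]) auto
    qed
  qed
qed

lemma add_circle_map_boundary_class:
  assumes "c \<in> MCL \<D> (P - K)" "i \<le> num_discs \<D>"
  shows "boundary_class \<D> i (add_circle_map (c, s)) = boundary_class \<D> i c"
proof -
  obtain N \<tau> where N: "(N, \<tau>) \<in> mcleaved_links \<D>" "N \<inter> Sig \<D> = P - K" "c = mcl_rel \<D> `` {(N, \<tau>)}"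
    using assms(1) by (rule MCL_E)
  have "boundary_class \<D> i (mcl_rel \<D> `` {add_circle K s (N, \<tau>)}) =
      cl_of (boundary \<D> i (add_circle K s (N, \<tau>)))"
    using boundary_class_eq[OF \<D> P assms(2) add_circle_mcleaved_links[OF N(1,2)]] by simp
  also have "\<dots> = cl_of (boundary \<D> i (N, \<tau>))"
    by (rule add_circle_boundary[OF N(1,2) assms(2)])
  also have "\<dots> = boundary_class \<D> i c"
    unfolding N(3) by (rule boundary_class_eq[OF \<D> planar_diagram_remove_circle assms(2) N(1,2), symmetric])
  finally show ?thesis
    unfolding add_circle_map_def case_prod_conv N(3) add_circle_class[OF N(1,2)] .
qed

lemma add_circle_map_weight_class:
  assumes "c \<in> MCL \<D> (P - K)"
  shows "weight_class \<D> (add_circle_map (c, s)) =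
    (case s of Plus \<Rightarrow> qhalf 2 | Minus \<Rightarrow> qhalf (- 2)) * weight_class \<D> c"
proof -
  obtain N \<tau> where N: "(N, \<tau>) \<in> mcleaved_links \<D>" "N \<inter> Sig \<D> = P - K" "c = mcl_rel \<D> `` {(N, \<tau>)}"
    using assms by (rule MCL_E)
  have "weight_class \<D> (mcl_rel \<D> `` {add_circle K s (N, \<tau>)}) = weight \<D> (add_circle K s (N, \<tau>))"
    using weight_class_eq[OF \<D> add_circle_mcleaved_links(1)[OF N(1,2)]] by simp
  then show ?thesis
    unfolding add_circle_map_def case_prod_conv N(3) add_circle_class[OF N(1,2)]
      weight_class_eq[OF \<D> N(1)] by (simp only: add_circle_weight[OF N(1,2)])
qed

lemma partition_coeffs_remove_circle:
  "partition_coeffs \<D> P cs = lscale (qhalf 2 + qhalf (- 2)) (partition_coeffs \<D> (P - K) cs)"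
proof -
  let ?Q = "\<lambda>c. \<forall>i\<in>{1..num_discs \<D>}. boundary_class \<D> i c = cs ! (i - 1)"
  let ?A = "{c \<in> MCL \<D> P. ?Q c}" and ?B = "{c \<in> MCL \<D> (P - K). ?Q c}"
  let ?term = "\<lambda>c. Poly_Mapping.single (boundary_class \<D> 0 c) (weight_class \<D> c)"
  have Q: "?Q (add_circle_map x) \<longleftrightarrow> ?Q (fst x)" if "x \<in> MCL \<D> (P - K) \<times> UNIV" for x
    using that add_circle_map_boundary_class[of "fst x" _ "snd x"] by auto
  have "bij_betw add_circle_map {x \<in> MCL \<D> (P - K) \<times> UNIV. ?Q (fst x)} ?A"
    by (rule bij_betw_Collect[OF add_circle_map_bij]) (rule Q)
  moreover have "{x \<in> MCL \<D> (P - K) \<times> (UNIV :: sign set). ?Q (fst x)} = ?B \<times> UNIV"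
    by (simp add: set_eq_iff)
  ultimately have "bij_betw add_circle_map (?B \<times> UNIV) ?A"
    by (simp only:)
  then have "partition_coeffs \<D> P cs = (\<Sum>x\<in>?B \<times> UNIV. ?term (add_circle_map x))"
    unfolding partition_coeffs_def by (rule sum.reindex_bij_betw[symmetric])
  also have "\<dots> = (\<Sum>c\<in>?B. \<Sum>s\<in>UNIV. ?term (add_circle_map (c, s)))"
    unfolding sum.cartesian_product by (rule sum.cong) auto
  also have "\<dots> = (\<Sum>c\<in>?B. lscale (qhalf 2 + qhalf (- 2)) (?term c))"
  proof (rule sum.cong[OF refl])
    fix c assume "c \<in> ?B"
    then have c: "c \<in> MCL \<D> (P - K)" by simp
    show "(\<Sum>s\<in>UNIV. ?term (add_circle_map (c, s))) = lscale (qhalf 2 + qhalf (- 2)) (?term c)"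
      using c by (simp add: UNIV_sign add_circle_map_boundary_class add_circle_map_weight_class
          lscale_single distrib_right single_add)
  qed
  also have "\<dots> = lscale (qhalf 2 + qhalf (- 2)) (partition_coeffs \<D> (P - K) cs)"
    by (simp add: partition_coeffs_def lscale_sum)
  finally show ?thesis .
qed

lemma partition_map_remove_circle:
  "partition_map \<D> P \<xi> = lscale (qhalf 2 + qhalf (- 2)) (partition_map \<D> (P - K) \<xi>)"
  unfolding partition_map_eq by (rule linear_ext_lscale) (rule partition_coeffs_remove_circle)

end


section \<open>The two properties of the partition map\<close>

theorem theorem12:
  fixes \<D> :: disc_config and P :: "point set"
  assumes "disc_configuration \<D>" and "planar_diagram \<D> P"
  shows
    "(\<forall>K\<in>components P. embedded_circle K \<and> K \<subseteq> interior_S2 (Sig \<D>) \<longrightarrow>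
        planar_diagram \<D> (P - K) \<and> (\<forall>i\<le>num_discs \<D>. half_points \<D> (P - K) i = half_points \<D> P i) \<and>
        (\<forall>\<xi>\<in>cl_tensor \<D> P.
           partition_map \<D> P \<xi> = lscale (qhalf 2 + qhalf (-2)) (partition_map \<D> (P - K) \<xi>))) \<and>
     (\<forall>n. \<forall>c\<in>CL n. reverse_cl c \<in> CL n \<and> reverse_cl (reverse_cl c) = c) \<and>
     (\<forall>\<xi>\<in>cl_tensor \<D> P.
        conj_tensor \<xi> \<in> cl_tensor \<D> P \<and>
        partition_map \<D> P (conj_tensor \<xi>) = conj_cl (partition_map \<D> P \<xi>))"
proof (intro conjI ballI allI impI)
  fix K assume K: "K \<in> components P" "embedded_circle K \<and> K \<subseteq> interior_S2 (Sig \<D>)"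
  note circle = assms K(1) conjunct1[OF K(2)] conjunct2[OF K(2)]
  show "planar_diagram \<D> (P - K)"
    by (rule planar_diagram_remove_circle[OF circle])
  show "half_points \<D> (P - K) i = half_points \<D> P i" if "i \<le> num_discs \<D>" for i
    by (rule half_points_remove_circle[OF circle that])
  show "partition_map \<D> P \<xi> = lscale (qhalf 2 + qhalf (-2)) (partition_map \<D> (P - K) \<xi>)" for \<xi>
    by (rule partition_map_remove_circle[OF circle])
next
  show "reverse_cl c \<in> CL n" if "c \<in> CL n" for n c
    using that by (rule reverse_cl_in_CL)
  show "reverse_cl (reverse_cl c) = c" for c
    by simp
  fix \<xi> assume \<xi>: "\<xi> \<in> cl_tensor \<D> P"
  show "conj_tensor \<xi> \<in> cl_tensor \<D> P"
    by (rule conj_tensor_in_cl_tensor[OF assms \<xi>])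
  show "partition_map \<D> P (conj_tensor \<xi>) = conj_cl (partition_map \<D> P \<xi>)"
    by (rule partition_map_conj[OF assms \<xi>])
qed

end
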